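(* Let $c$ be a Coxeter element of $W$. For every function $f:I\to\mathbb{R}$ such that $f(i)=f(i^* )$ for all $i\in I$ and $\sum_{i\in I}a_{ij}f(i)>0$ for all $j\in I$, there exists a point $a$ in the fundamental Weyl chamber $D$ such that $\mathrm{Asso}_c^a(W)=\mathrm{Asso}_c^f(W)$.
   Context: Let $I$ be a finite type Dynkin diagram (vertex set $I$), with crystallographic root system, simple roots $\alpha_i$, fundamental weights $\omega_i$, weight lattice $P$, $P_\mathbb{R}=P\otimes\mathbb{R}$ equipped with a $W$-invariant inner product $(\cdot,\cdot)$, dual $P_\mathbb{R}^*$, Weyl group $W$ with simple reflections $s_i$, longest element $w_0$, Cartan matrix $(a_{ij})$ with $\alpha_j=\sum_i a_{ij}\omega_i$. $D$ is the $\mathbb{R}_{\ge0}$-span of the fundamental weights. Let $\omega_{i^*}:=-w_0\omega_i$. A Coxeter element $c$ is a product of all $s_i$, each once; $h(i;c)$ is the minimal positive integer with $c^{h(i;c)}\omega_i=-\omega_{i^*}$; $\Pi(c):=\{c^m\omega_i:0\le m\le h(i;c)\}$. With $\tau_c(-\omega_i)=\omega_i$, $\tau_c(\lambda)=c\lambda$ otherwise, and $[\gamma;\alpha_i]$ the $\alpha_i$-coefficient, the compatibility degree is the unique $\tau_c$-invariant $(\bullet||\bullet)_c$ on $\Pi(c)$ with $(\omega_i||\lambda)_c=\max\{[(c^{-1}-1)\lambda;\alpha_i],0\}$; cones spanned by pairwise compatible ($(\lambda||\mu)_c=0$) subsets form a complete simplicial fan $\mathcal{F}_c^\Pi$. $F_c$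 is the continuous function on $P_\mathbb{R}$, linear on maximal cones of $\mathcal{F}_c^\Pi$, with $F_c(c^m\omega_i)=f(i)$; $\mathrm{Asso}_c^f(W):=\{\varphi\in P_\mathbb{R}^*:\varphi(\lambda)\le F_c(\lambda)\ \forall\lambda\in\Pi(c)\}$. Sorting: fix a reduced expression of $c$ and let $c^\infty$ be the infinite concatenation of copies of it. For $w\in W$, its $c$-sorting word is the reduced word for $w$ occurring as a subword of $c^\infty$ whose set of positions is lexicographically first; writing $c_J$ for the subword of $c$ using only letters $s_j$, $j\in J$, the $c$-sorting word has the form $c_{I_1}c_{I_2}\cdots c_{I_k}$ (the $c$-factorization, independent of the chosen reduced expression of $c$). $w$ is $c$-sortable if $I_1\supseteq I_2\supseteq\cdots\supseteq I_k$; $w$ is $c$-antisortable if $ww_0$ is $c^{-1}$-sortable; $w$ is a $c$-singleton if it is both. For $a\in P_\mathbb{R}$ define $\mathrm{Asso}_c^a(W):=\{\varphi\in P_\mathbb{R}^*:\varphi(w\omega_j)\le(a,\omega_j)$ for all $c$-singletons $w$ and all $j\in I\}$ (the polytope of Hohlweg–Lange–Thomas). *)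

theory Defs
  imports Complex_Main
begin

text \<open>Weights are written in the basis of fundamental weights: a point of P_R is a
  function 'i => real, lambda = sum_k lambda k * omega_k.  The Cartan matrix A satisfies
  alpha_j = sum_i A i j * omega_i.  Linear functionals (elements of P_R^* ) are represented
  by their coefficient vectors with respect to the dual basis.\<close>

definition omega :: "'i \<Rightarrow> ('i \<Rightarrow> real)" where
  "omega i = (\<lambda>k. if k = i then 1 else 0)"

definition simple_root :: "('i \<Rightarrow> 'i \<Rightarrow> int) \<Rightarrow> 'i \<Rightarrow> ('i \<Rightarrow> real)" where
  "simple_root A j = (\<lambda>i. of_int (A i j))"

text \<open>s_i lambda = lambda - <lambda, alpha_i^vee> alpha_i, and <omega_k, alpha_i^vee> = delta_ki.\<close>
definition sref :: "('i \<Rightarrow> 'i \<Rightarrow> int) \<Rightarrow> 'i \<Rightarrow> ('i \<Rightarrow> real) \<Rightarrow> ('i \<Rightarrow> real)" where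
  "sref A i x = (\<lambda>k. x k - x i * of_int (A k i))"

definition word_eval :: "('i \<Rightarrow> 'i \<Rightarrow> int) \<Rightarrow> 'i list \<Rightarrow> ('i \<Rightarrow> real) \<Rightarrow> ('i \<Rightarrow> real)" where
  "word_eval A ws = foldr (\<lambda>i f. sref A i \<circ> f) ws id"

definition weyl :: "('i \<Rightarrow> 'i \<Rightarrow> int) \<Rightarrow> (('i \<Rightarrow> real) \<Rightarrow> ('i \<Rightarrow> real)) set" where
  "weyl A = range (word_eval A)"

definition wlen :: "('i \<Rightarrow> 'i \<Rightarrow> int) \<Rightarrow> (('i \<Rightarrow> real) \<Rightarrow> ('i \<Rightarrow> real)) \<Rightarrow> nat" where
  "wlen A w = (LEAST n. \<exists>ws. length ws = n \<and> word_eval A ws = w)"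

definition finite_type_cartan :: "('i::finite \<Rightarrow> 'i \<Rightarrow> int) \<Rightarrow> bool" where
  "finite_type_cartan A \<longleftrightarrow>
     (\<forall>i. A i i = 2) \<and> (\<forall>i j. i \<noteq> j \<longrightarrow> A i j \<le> 0) \<and>
     (\<forall>i j. A i j = 0 \<longleftrightarrow> A j i = 0) \<and> finite (weyl A)"

definition longest :: "('i \<Rightarrow> 'i \<Rightarrow> int) \<Rightarrow> ('i \<Rightarrow> real) \<Rightarrow> ('i \<Rightarrow> real)" where
  "longest A = (SOME w. w \<in> weyl A \<and> (\<forall>v \<in> weyl A. wlen A v \<le> wlen A w))"

definition istar :: "('i \<Rightarrow> 'i \<Rightarrow> int) \<Rightarrow> 'i \<Rightarrow> 'i" where
  "istar A i = (THE j. (\<lambda>k. - longest A (omega i) k) = omega j)"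

definition coxeter_word :: "'i::finite list \<Rightarrow> bool" where
  "coxeter_word cw \<longleftrightarrow> distinct cw \<and> set cw = UNIV"

definition cox :: "('i \<Rightarrow> 'i \<Rightarrow> int) \<Rightarrow> 'i list \<Rightarrow> ('i \<Rightarrow> real) \<Rightarrow> ('i \<Rightarrow> real)" where
  "cox A cw = word_eval A cw"

text \<open>W-invariant inner product on P_R, given by its Gram matrix G on fundamental weights.\<close>
definition ip :: "('i::finite \<Rightarrow> 'i \<Rightarrow> real) \<Rightarrow> ('i \<Rightarrow> real) \<Rightarrow> ('i \<Rightarrow> real) \<Rightarrow> real" where
  "ip G x y = (\<Sum>k\<in>UNIV. \<Sum>l\<in>UNIV. x k * G k l * y l)"

definition W_inv_inner :: "('i::finite \<Rightarrow> 'i \<Rightarrow> int) \<Rightarrow> ('i \<Rightarrow> 'i \<Rightarrow> real) \<Rightarrow> bool" where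
  "W_inv_inner A G \<longleftrightarrow> (\<forall>k l. G k l = G l k) \<and> (\<forall>x. x \<noteq> (\<lambda>_. 0) \<longrightarrow> ip G x x > 0) \<and>
     (\<forall>i x y. ip G (sref A i x) (sref A i y) = ip G x y)"

definition pair :: "('i::finite \<Rightarrow> real) \<Rightarrow> ('i \<Rightarrow> real) \<Rightarrow> real" where
  "pair \<phi> x = (\<Sum>k\<in>UNIV. \<phi> k * x k)"

definition fund_chamber :: "('i \<Rightarrow> real) set" where
  "fund_chamber = {a. \<forall>i. 0 \<le> a i}"

definition hc :: "('i \<Rightarrow> 'i \<Rightarrow> int) \<Rightarrow> 'i list \<Rightarrow> 'i \<Rightarrow> nat" where
  "hc A cw i = (LEAST h. 0 < h \<and> (cox A cw ^^ h) (omega i) = (\<lambda>k. - omega (istar A i) k))"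

definition Pi_c :: "('i \<Rightarrow> 'i \<Rightarrow> int) \<Rightarrow> 'i list \<Rightarrow> ('i \<Rightarrow> real) set" where
  "Pi_c A cw = {(cox A cw ^^ m) (omega i) | i m. m \<le> hc A cw i}"

text \<open>Asso_c^f(W): since F_c(c^m omega_i) = f(i), the defining inequalities
  phi(lambda) <= F_c(lambda), lambda in Pi(c), read phi(c^m omega_i) <= f(i).\<close>
definition asso_f :: "('i::finite \<Rightarrow> 'i \<Rightarrow> int) \<Rightarrow> 'i list \<Rightarrow> ('i \<Rightarrow> real) \<Rightarrow> ('i \<Rightarrow> real) set" where
  "asso_f A cw f = {\<phi>. \<forall>i m. m \<le> hc A cw i \<longrightarrow> pair \<phi> ((cox A cw ^^ m) (omega i)) \<le> f i}"

definition cinf :: "'i list \<Rightarrow> nat \<Rightarrow> 'i" where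
  "cinf cw p = cw ! (p mod length cw)"

definition subword_pos :: "('i \<Rightarrow> 'i \<Rightarrow> int) \<Rightarrow> 'i list \<Rightarrow> (('i \<Rightarrow> real) \<Rightarrow> ('i \<Rightarrow> real)) \<Rightarrow> nat list \<Rightarrow> bool" where
  "subword_pos A cw w ps \<longleftrightarrow> sorted_wrt (<) ps \<and> length ps = wlen A w \<and>
      word_eval A (map (cinf cw) ps) = w"

definition sorting_pos :: "('i \<Rightarrow> 'i \<Rightarrow> int) \<Rightarrow> 'i list \<Rightarrow> (('i \<Rightarrow> real) \<Rightarrow> ('i \<Rightarrow> real)) \<Rightarrow> nat list \<Rightarrow> bool" where
  "sorting_pos A cw w ps \<longleftrightarrow> subword_pos A cw w ps \<and>
      (\<forall>qs. subword_pos A cw w qs \<longrightarrow> qs = ps \<or> (ps, qs) \<in> lexord {(a, b). a < b})"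

text \<open>I_{m+1}: letters of the c-sorting word lying in the (m+1)-st copy of c\<close>
definition block :: "'i list \<Rightarrow> nat list \<Rightarrow> nat \<Rightarrow> 'i set" where
  "block cw ps m = {cinf cw p | p. p \<in> set ps \<and> p div length cw = m}"

definition c_sortable :: "('i \<Rightarrow> 'i \<Rightarrow> int) \<Rightarrow> 'i list \<Rightarrow> (('i \<Rightarrow> real) \<Rightarrow> ('i \<Rightarrow> real)) \<Rightarrow> bool" where
  "c_sortable A cw w \<longleftrightarrow> (\<exists>ps. sorting_pos A cw w ps \<and> (\<forall>m. block cw ps (Suc m) \<subseteq> block cw ps m))"

text \<open>w c-antisortable iff w w_0 is c^{-1}-sortable (rev cw is a reduced word of c^{-1})\<close>
definition c_antisortable :: "('i \<Rightarrow> 'i \<Rightarrow> int) \<Rightarrow> 'i list \<Rightarrow> (('i \<Rightarrow> real) \<Rightarrow> ('i \<Rightarrow> real)) \<Rightarrow> bool" where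
  "c_antisortable A cw w \<longleftrightarrow> c_sortable A (rev cw) (w \<circ> longest A)"

definition c_singleton :: "('i \<Rightarrow> 'i \<Rightarrow> int) \<Rightarrow> 'i list \<Rightarrow> (('i \<Rightarrow> real) \<Rightarrow> ('i \<Rightarrow> real)) \<Rightarrow> bool" where
  "c_singleton A cw w \<longleftrightarrow> w \<in> weyl A \<and> c_sortable A cw w \<and> c_antisortable A cw w"

definition asso_a :: "('i::finite \<Rightarrow> 'i \<Rightarrow> int) \<Rightarrow> 'i list \<Rightarrow> ('i \<Rightarrow> 'i \<Rightarrow> real) \<Rightarrow> ('i \<Rightarrow> real) \<Rightarrow> ('i \<Rightarrow> real) set" where
  "asso_a A cw G a = {\<phi>. \<forall>w j. c_singleton A cw w \<longrightarrow> pair \<phi> (w (omega j)) \<le> ip G a (omega j)}"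

end

theory Submission
  imports Defs "HOL-Library.Function_Algebras"
begin

text \<open>
  Choose \<^term>\<open>a\<close> with inner products \<^term>\<open>f j\<close> against the fundamental weights; positivity of the
  combinations of \<^term>\<open>f\<close> says exactly that this point is dominant. It remains to see that the weights
  \<open>w \<omega>\<^sub>j\<close>, for \<open>w\<close> a \<open>c\<close>-singleton, are the weights \<open>c\<^sup>m \<omega>\<^sub>j\<close> with \<open>0 \<le> m \<le> h(j;c)\<close>.

  Sortability obeys Reading's recursion: if \<open>s\<close> is initial in \<open>c\<close>, then \<open>w\<close> is \<open>c\<close>-sortable iff either
  \<open>s\<close> is a descent and \<open>s w\<close> is \<open>s c s\<close>-sortable, or \<open>w\<close> lies in the parabolic subgroup omitting \<open>s\<close>
  and is \<open>s c\<close>-sortable there. Two consequences follow by tracking the Euler form of \<open>c\<close>, which is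
  transported by \<open>s\<close> to the Euler form of \<open>s c s\<close>: the longest element is sortable for every \<open>c\<close>, and
  the inversions of a sortable element are aligned with the orientation given by \<open>c\<close>. Alignment of
  \<open>w w\<^sub>0\<close> forces the first letter \<open>s\<close> of a singleton \<open>w \<noteq> 1\<close> to be initial in \<open>c\<close> up to commutations,
  whence \<open>s w\<close> is an \<open>s c s\<close>-singleton. Induction on the length then identifies \<open>w \<omega>\<^sub>j\<close> with a power
  \<open>c\<^sup>m \<omega>\<^sub>j\<close> reached through smaller singletons, and the chain for \<open>w\<^sub>0\<close> reaches \<open>w\<^sub>0 \<omega>\<^sub>j\<close>.
\<close>

section \<open>Linear algebra and words\<close>

definition smul :: "real \<Rightarrow> ('i \<Rightarrow> real) \<Rightarrow> ('i \<Rightarrow> real)"  (infixr "\<odot>" 75) where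
  "r \<odot> x = (\<lambda>k. r * x k)"

lemma smul_apply [simp]: "(r \<odot> x) k = r * x k"
  by (simp add: smul_def)

lemma ip_add_left: "ip G (x + y) z = ip G x z + ip G y z"
  by (simp add: ip_def algebra_simps sum.distrib)

lemma ip_add_right: "ip G x (y + z) = ip G x y + ip G x z"
  by (simp add: ip_def algebra_simps sum.distrib)

lemma ip_smul_left: "ip G (r \<odot> x) z = r * ip G x z"
  by (simp add: ip_def sum_distrib_left mult.assoc)

lemma ip_smul_right: "ip G x (r \<odot> z) = r * ip G x z"
  by (simp add: ip_def sum_distrib_left mult_ac)

lemma ip_minus_left: "ip G (- x) z = - ip G x z"
  by (simp add: ip_def sum_negf)

lemma ip_minus_right: "ip G x (- z) = - ip G x z"
  by (simp add: ip_def sum_negf)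

lemma ip_diff_left: "ip G (x - y) z = ip G x z - ip G y z"
  by (simp add: ip_def algebra_simps sum_subtractf)

lemma ip_diff_right: "ip G x (y - z) = ip G x y - ip G x z"
  by (simp add: ip_def algebra_simps sum_subtractf)

lemmas ip_linear = ip_add_left ip_add_right ip_smul_left ip_smul_right
  ip_minus_left ip_minus_right ip_diff_left ip_diff_right

lemma ip_expand_right: "ip G x y = (\<Sum>l\<in>UNIV. y l * ip G x (omega l))"
proof -
  have "ip G x (omega l) = (\<Sum>k\<in>UNIV. x k * G k l)" for l
    by (simp add: ip_def omega_def if_distrib cong: if_cong)
  then have "(\<Sum>l\<in>UNIV. y l * ip G x (omega l)) = (\<Sum>l\<in>UNIV. \<Sum>k\<in>UNIV. x k * G k l * y l)"
    by (simp add: sum_distrib_left mult_ac)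
  also have "\<dots> = ip G x y"
    unfolding ip_def by (rule sum.swap)
  finally show ?thesis by simp
qed

lemma omega_apply: "omega i k = (if k = i then 1 else 0)"
  by (simp add: omega_def)

lemma omega_inject [simp]: "omega i = omega j \<longleftrightarrow> i = j"
  by (metis omega_apply zero_neq_one)

lemma sref_eq: "sref A i x = x - x i \<odot> simple_root A i"
  by (auto simp: sref_def simple_root_def)

lemma simple_root_apply: "simple_root A j i = of_int (A i j)"
  by (simp add: simple_root_def)

lemma sref_add: "sref A i (x + y) = sref A i x + sref A i y"
  by (auto simp: sref_def algebra_simps)

lemma sref_smul: "sref A i (r \<odot> x) = r \<odot> sref A i x"
  by (auto simp: sref_def algebra_simps)

section \<open>Words in the simple reflections, Weyl group elements and length\<close>

lemma word_eval_Nil [simp]: "word_eval A [] = id"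
  by (simp add: word_eval_def)

lemma word_eval_Cons [simp]: "word_eval A (i # ws) = sref A i \<circ> word_eval A ws"
  by (simp add: word_eval_def)

lemma word_eval_append [simp]: "word_eval A (us @ vs) = word_eval A us \<circ> word_eval A vs"
  by (induction us) (simp_all add: comp_assoc)

lemma weylI [intro]: "word_eval A ws \<in> weyl A"
  by (simp add: weyl_def)

lemma weylE: "w \<in> weyl A \<Longrightarrow> (\<And>ws. w = word_eval A ws \<Longrightarrow> P) \<Longrightarrow> P"
  by (auto simp: weyl_def)

lemma weyl_comp [intro]: "v \<in> weyl A \<Longrightarrow> w \<in> weyl A \<Longrightarrow> v \<circ> w \<in> weyl A"
  by (metis weylE weylI word_eval_append)

lemma id_in_weyl [intro, simp]: "id \<in> weyl A"
  by (metis weylI word_eval_Nil)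

lemma sref_in_weyl [intro, simp]: "sref A i \<in> weyl A"
  by (metis comp_id weylI word_eval_Cons word_eval_Nil)

lemma weyl_induct [consumes 1, case_names id sref]:
  assumes "w \<in> weyl A" "P id" "\<And>i w. w \<in> weyl A \<Longrightarrow> P w \<Longrightarrow> P (sref A i \<circ> w)"
  shows "P w"
proof -
  have "P (word_eval A ws)" for ws
    using assms(2,3) by (induction ws) auto
  then show ?thesis
    using assms(1) by (auto elim: weylE)
qed

lemma weyl_add: "w \<in> weyl A \<Longrightarrow> w (x + y) = w x + w y"
  by (induction rule: weyl_induct) (simp_all only: id_apply comp_apply sref_add)

lemma weyl_smul: "w \<in> weyl A \<Longrightarrow> w (r \<odot> x) = r \<odot> w x"
  by (induction rule: weyl_induct) (simp_all only: id_apply comp_apply sref_smul)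

lemma minus_eq_smul: "- x = (- 1) \<odot> x"
  by auto

lemma weyl_minus: "w \<in> weyl A \<Longrightarrow> w (- x) = - w x"
  by (simp only: minus_eq_smul weyl_smul)

lemma weyl_diff: "w \<in> weyl A \<Longrightarrow> w (x - y) = w x - w y"
  by (metis diff_conv_add_uminus weyl_add weyl_minus)

lemma sum_fun_apply: "(\<Sum>i\<in>S. f i) k = (\<Sum>i\<in>S. f i k)" for f :: "'b \<Rightarrow> 'i \<Rightarrow> real"
  by (induction S rule: infinite_finite_induct) auto

lemma weyl_zero: "w \<in> weyl A \<Longrightarrow> w 0 = 0"
  using weyl_add[of w A 0 0] by simp

lemma weyl_sum: "w \<in> weyl A \<Longrightarrow> w (\<Sum>i\<in>S. f i) = (\<Sum>i\<in>S. w (f i))"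
  by (induction S rule: infinite_finite_induct) (simp_all only: sum.infinite sum.empty weyl_zero sum.insert weyl_add not_False_eq_True)

lemma omega_basis: "(x :: 'i::finite \<Rightarrow> real) = (\<Sum>i\<in>UNIV. x i \<odot> omega i)"
  by (auto simp: sum_fun_apply omega_apply if_distrib cong: if_cong)

lemma weyl_eqI:
  fixes A :: "'i::finite \<Rightarrow> 'i \<Rightarrow> int"
  assumes "v \<in> weyl A" "w \<in> weyl A" "\<And>i. v (omega i) = w (omega i)"
  shows "v = w"
proof
  fix x
  have "v (\<Sum>i\<in>UNIV. x i \<odot> omega i) = w (\<Sum>i\<in>UNIV. x i \<odot> omega i)"
    using assms by (simp add: weyl_sum weyl_smul)
  then show "v x = w x"
    using omega_basis[of x] by simp
qed

lemma sref_omega: "sref A i (omega j) = (if i = j then omega j - simple_root A i else omega j)"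
  by (auto simp: sref_eq omega_apply)

lemma wlen_le: "wlen A (word_eval A ws) \<le> length ws"
  unfolding wlen_def by (rule Least_le) blast

lemma reduced_word:
  assumes "w \<in> weyl A"
  obtains ws where "length ws = wlen A w" "word_eval A ws = w"
proof -
  have "\<exists>n ws. length ws = n \<and> word_eval A ws = w"
    using assms by (auto elim: weylE)
  then have "\<exists>ws. length ws = wlen A w \<and> word_eval A ws = w"
    unfolding wlen_def by (rule LeastI_ex)
  then show ?thesis using that by blast
qed

lemma wlen_comp_le:
  assumes "v \<in> weyl A" "w \<in> weyl A"
  shows "wlen A (v \<circ> w) \<le> wlen A v + wlen A w"
proof -
  obtain us vs where "length us = wlen A v" "word_eval A us = v"
    "length vs = wlen A w" "word_eval A vs = w"
    using assms by (metis reduced_word)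
  then show ?thesis
    using wlen_le[of A "us @ vs"] by simp
qed

lemma wlen_word_comp_le:
  assumes "v \<in> weyl A"
  shows "wlen A (v \<circ> word_eval A ws) \<le> wlen A v + length ws"
  using wlen_comp_le[OF assms weylI[of A ws]] wlen_le[of A ws] by linarith

lemma wlen_id [simp]: "wlen A id = 0"
  using wlen_le[of A "[]"] by simp

lemma wlen_0: "w \<in> weyl A \<Longrightarrow> wlen A w = 0 \<Longrightarrow> w = id"
  by (metis length_0_conv reduced_word word_eval_Nil)

section \<open>The invariant form and the coefficients in simple roots\<close>

locale cartan_weyl =
  fixes A :: "'i::finite \<Rightarrow> 'i \<Rightarrow> int" and G :: "'i \<Rightarrow> 'i \<Rightarrow> real"
  assumes cartan: "finite_type_cartan A" and form: "W_inv_inner A G"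
begin

abbreviation "W \<equiv> weyl A"
abbreviation "s \<equiv> sref A"
abbreviation "ev \<equiv> word_eval A"
abbreviation "\<alpha> \<equiv> simple_root A"
abbreviation "len \<equiv> wlen A"
abbreviation inn :: "('i \<Rightarrow> real) \<Rightarrow> ('i \<Rightarrow> real) \<Rightarrow> real"  ("\<langle>_, _\<rangle>")
  where "inn x y \<equiv> ip G x y"

lemma A_diag [simp]: "A i i = 2"
  using cartan by (simp add: finite_type_cartan_def)

lemma A_off: "i \<noteq> j \<Longrightarrow> A i j \<le> 0"
  using cartan by (simp add: finite_type_cartan_def)

lemma A_zero: "A i j = 0 \<longleftrightarrow> A j i = 0"
  using cartan by (simp add: finite_type_cartan_def)

lemma finite_W: "finite W"
  using cartan by (simp add: finite_type_cartan_def)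

lemma ip_sym: "\<langle>x, y\<rangle> = \<langle>y, x\<rangle>"
proof -
  have sym: "G k l = G l k" for k l
    using form unfolding W_inv_inner_def by blast
  have "\<langle>x, y\<rangle> = (\<Sum>l\<in>UNIV. \<Sum>k\<in>UNIV. x k * G k l * y l)"
    unfolding ip_def by (rule sum.swap)
  also have "\<dots> = \<langle>y, x\<rangle>"
    unfolding ip_def by (intro sum.cong refl) (simp add: sym mult_ac)
  finally show ?thesis .
qed

lemma ip_pos: "x \<noteq> 0 \<Longrightarrow> \<langle>x, x\<rangle> > 0"
  using form by (simp add: W_inv_inner_def zero_fun_def)

lemma ip_zero_iff: "\<langle>x, x\<rangle> = 0 \<longleftrightarrow> x = 0"
proof
  assume "\<langle>x, x\<rangle> = 0"
  then show "x = 0" using ip_pos[of x] by force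
qed (simp add: ip_def)

lemma ip_s: "\<langle>s i x, s i y\<rangle> = \<langle>x, y\<rangle>"
  using form by (simp add: W_inv_inner_def)

lemma ip_W: "w \<in> W \<Longrightarrow> \<langle>w x, w y\<rangle> = \<langle>x, y\<rangle>"
  by (induction rule: weyl_induct) (simp_all add: ip_s)

text \<open>Half the squared length of \<open>\<alpha> i\<close>. These numbers symmetrize the
  Cartan matrix, as \<open>ip_root_root\<close> shows.\<close>

definition D :: "'i \<Rightarrow> real" where "D i = \<langle>\<alpha> i, \<alpha> i\<rangle> / 2"

lemma D_pos: "D i > 0"
proof -
  have "\<alpha> i i \<noteq> 0" by (simp add: simple_root_apply)
  then have "\<alpha> i \<noteq> 0" by (metis zero_fun_apply)
  then show ?thesis using ip_pos by (simp add: D_def)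
qed

lemma s_root [simp]: "s i (\<alpha> i) = - \<alpha> i"
  by (auto simp: sref_def simple_root_def)

lemma s_s [simp]: "s i (s i x) = x"
  by (auto simp: sref_def)

lemma s_comp_s [simp]: "s i \<circ> s i = id"
  by auto

lemma s_comp_s_comp [simp]: "s i \<circ> (s i \<circ> w) = w"
  by auto

text \<open>Invariance under \<open>s i\<close>, which negates \<open>\<alpha> i\<close>, yields a
  linear equation for the pairing.\<close>

lemma ip_root: "\<langle>x, \<alpha> i\<rangle> = x i * D i"
proof -
  have "\<langle>x, \<alpha> i\<rangle> = \<langle>s i x, - \<alpha> i\<rangle>"
    using ip_s[of i x "\<alpha> i"] by simp
  then show ?thesis
    by (simp add: sref_eq ip_linear D_def algebra_simps)
qed

lemma ip_root_root: "\<langle>\<alpha> i, \<alpha> j\<rangle> = of_int (A j i) * D j"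
  by (simp add: ip_root simple_root_apply)

lemma ip_root_omega: "\<langle>\<alpha> i, omega j\<rangle> = (if i = j then D i else 0)"
  using ip_root[of "omega j" i] by (auto simp: ip_sym omega_apply)

text \<open>The coefficient of a simple root, read off by duality with the fundamental weights.\<close>
definition cf :: "'i \<Rightarrow> ('i \<Rightarrow> real) \<Rightarrow> real" where
  "cf i x = \<langle>x, omega i\<rangle> / D i"

lemma cf_linear:
  "cf i (x + y) = cf i x + cf i y" "cf i (x - y) = cf i x - cf i y"
  "cf i (- x) = - cf i x" "cf i (r \<odot> x) = r * cf i x"
  by (simp_all add: cf_def ip_linear add_divide_distrib diff_divide_distrib)

lemma cf_root: "cf i (\<alpha> j) = (if i = j then 1 else 0)"
  using D_pos[of i] D_pos[of j] by (simp add: cf_def ip_root_omega)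

lemma cf_s: "cf i (s j x) = cf i x - (if i = j then x j else 0)"
  by (simp add: sref_eq cf_linear cf_root)

text \<open>A difference with vanishing coefficients is orthogonal to every fundamental weight,
  hence to itself, and the form is definite.\<close>

lemma cf_eqI:
  assumes "\<And>i. cf i x = cf i y"
  shows "x = y"
proof -
  have "\<langle>x - y, omega i\<rangle> = 0" for i
    using assms[of i] D_pos[of i] by (simp add: cf_def ip_linear)
  then have "\<langle>x - y, x - y\<rangle> = 0"
    by (subst ip_expand_right) simp
  then show ?thesis by (simp add: ip_zero_iff)
qed

text \<open>Pair \<open>x\<close> with \<open>\<alpha> j\<close>, expand that root in fundamental
  weights, and transpose the Cartan matrix by means of \<open>D\<close>.\<close>

lemma coord_cf: "x j = (\<Sum>i\<in>UNIV. cf i x * of_int (A j i))"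
proof -
  have "x j * D j = (\<Sum>l\<in>UNIV. of_int (A l j) * \<langle>x, omega l\<rangle>)"
    using ip_expand_right[of G x "\<alpha> j"] by (simp add: ip_root simple_root_apply)
  also have "\<dots> = (\<Sum>l\<in>UNIV. cf l x * of_int (A j l) * D j)"
  proof (rule sum.cong)
    fix l
    have "of_int (A l j) * D l = of_int (A j l) * D j"
      using ip_root_root[of l j] ip_root_root[of j l] ip_sym[of "\<alpha> l" "\<alpha> j"] by simp
    then show "of_int (A l j) * \<langle>x, omega l\<rangle> = cf l x * of_int (A j l) * D j"
      using D_pos[of l] by (simp add: cf_def field_simps)
  qed simp
  finally show ?thesis
    using D_pos[of j] by (simp add: sum_distrib_right[symmetric])
qed

text \<open>The cone spanned by the simple roots; on a root it expresses positivity.\<close>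

definition nonneg :: "('i \<Rightarrow> real) \<Rightarrow> bool" where
  "nonneg x \<longleftrightarrow> (\<forall>i. cf i x \<ge> 0)"

lemma nonneg_combine: "nonneg x \<Longrightarrow> nonneg y \<Longrightarrow> a \<ge> 0 \<Longrightarrow> b \<ge> 0 \<Longrightarrow> nonneg (a \<odot> x + b \<odot> y)"
  by (simp add: nonneg_def cf_linear)

lemma nonneg_antisym: "nonneg x \<Longrightarrow> nonneg (- x) \<Longrightarrow> x = 0"
  by (rule cf_eqI) (metis add.inverse_neutral cf_linear(3) minus_zero neg_0_le_iff_le nonneg_def
     order_antisym cf_linear(2) diff_self)

lemma nonneg_root: "nonneg (\<alpha> i)"
  by (simp add: nonneg_def cf_root)

end

section \<open>Positivity of roots\<close>

text \<open>Alternates two letters and ends in the first argument. Fixing the right end makes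
  shorter words suffixes of longer ones.\<close>

fun alt_word :: "'i \<Rightarrow> 'i \<Rightarrow> nat \<Rightarrow> 'i list" where
  "alt_word a b 0 = []"
| "alt_word a b (Suc k) = alt_word b a k @ [a]"

lemma length_alt_word [simp]: "length (alt_word a b k) = k"
  by (induction k arbitrary: a b) simp_all

lemma alt_word_suffix:
  "m \<le> k \<Longrightarrow> \<exists>us. alt_word a b k = us @ alt_word a b m \<and> length us = k - m"
proof (induction m arbitrary: a b k)
  case (Suc m)
  then obtain k' where k: "k = Suc k'" "m \<le> k'" by (cases k) auto
  with Suc.IH[of k' b a] show ?case by auto
qed simp

text \<open>The leftmost letter depends on the parity of \<open>k\<close>, so it is named only up to
  exchange with the letter that extends the word.\<close>

lemma alt_word_first:
  "k > 0 \<Longrightarrow> \<exists>x y us. {x, y} = {a, b} \<and> alt_word a b k = x # us \<and> alt_word a b (Suc k) = y # alt_word a b k"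
proof (induction k arbitrary: a b)
  case (Suc k)
  show ?case
  proof (cases "k = 0")
    case False
    then obtain x y us where "{x, y} = {b, a}" "alt_word b a k = x # us"
      "alt_word b a (Suc k) = y # alt_word b a k"
      using Suc.IH[of b a] by auto
    then show ?thesis
      by (intro exI[of _ x] exI[of _ y] exI[of _ "us @ [a]"]) auto
  qed (auto intro!: exI[of _ a] exI[of _ b])
qed simp

section \<open>Rank two: braid relations and positivity\<close>

context cartan_weyl
begin

text \<open>\<open>?v\<close> is a multiple of the component of \<open>\<alpha> i\<close> orthogonal
  to \<open>\<alpha> j\<close>; its positive squared length contains the factor four minus the
  product of the two Cartan entries.\<close>

lemma cartan_product: "i \<noteq> j \<Longrightarrow> A i j * A j i < 4"
proof -
  assume ij: "i \<noteq> j"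
  let ?v = "D j \<odot> \<alpha> i - (of_int (A j i) * D j / 2) \<odot> \<alpha> j"
  have "cf i ?v \<noteq> 0"
    using ij D_pos[of j] by (simp add: cf_linear cf_root)
  then have "?v \<noteq> 0"
    by (metis cf_linear(2) diff_self eq_iff_diff_eq_0)
  then have "\<langle>?v, ?v\<rangle> > 0" by (rule ip_pos)
  have e: "of_int (A j i) * D j = of_int (A i j) * D i"
    using ip_root_root[of i j] ip_root_root[of j i] ip_sym[of "\<alpha> i" "\<alpha> j"] by simp
  have "\<langle>?v, ?v\<rangle> = D j * D j * (2 * D i) - 2 * D j * (of_int (A j i) * D j / 2) * (of_int (A j i) * D j)
     + (of_int (A j i) * D j / 2)^2 * (2 * D j)"
    by (simp add: ip_linear ip_root_root ip_sym[of "\<alpha> j" "\<alpha> i"] algebra_simps power2_eq_square e[symmetric])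
  also have "\<dots> = D j * D j * (2 * D i) - D j * (of_int (A j i) * D j) * (of_int (A j i) * D j) / 2"
    by (simp add: field_simps power2_eq_square)
  also have "\<dots> = D j * D j * D i * (4 - of_int (A j i) * of_int (A i j)) / 2"
    by (subst (2) e) (simp add: field_simps)
  finally have "0 < D j * D j * D i * (4 - real_of_int (A j i) * of_int (A i j))"
    using \<open>\<langle>?v, ?v\<rangle> > 0\<close> by simp
  then have "real_of_int (A j i) * of_int (A i j) < 4"
    using D_pos[of i] D_pos[of j] mult_pos_pos[OF mult_pos_pos[OF D_pos[of j] D_pos[of j]] D_pos[of i]]
    by (auto simp: zero_less_mult_iff)
  then have "real_of_int (A i j * A j i) < real_of_int 4"
    by (simp add: mult.commute)
  then show ?thesis by linarith
qed

lemma cartan_cases: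
  assumes "i \<noteq> j"
  shows "(A i j, A j i) \<in> {(0, 0), (-1, -1), (-1, -2), (-2, -1), (-1, -3), (-3, -1)}"
proof -
  define a b where "a = - A i j" and "b = - A j i"
  have ab: "a * b < 4" "a \<ge> 0" "b \<ge> 0" "a = 0 \<longleftrightarrow> b = 0"
    using cartan_product[OF assms] A_off[OF assms] A_off[of j i] assms A_zero[of i j]
    by (auto simp: a_def b_def)
  have "a < 4 \<and> b < 4"
  proof (cases "a = 0")
    case False
    with ab have "a \<ge> 1" "b \<ge> 1" by auto
    then have "a * 1 \<le> a * b" "1 * b \<le> a * b" by (auto intro: mult_mono)
    with ab show ?thesis by linarith
  qed (use ab in auto)
  then have "a \<in> {0, 1, 2, 3}" "b \<in> {0, 1, 2, 3}" using ab by auto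
  with ab have "(a, b) \<in> {(0, 0), (1, 1), (1, 2), (2, 1), (1, 3), (3, 1)}" by auto
  then show ?thesis by (auto simp: a_def b_def)
qed

text \<open>Both reflections move a point only within the plane of the two roots, so evaluating an
  alternating word becomes arithmetic on two coefficients.\<close>

lemma s_plane:
  "s i (x - p \<odot> \<alpha> i - q \<odot> \<alpha> j) = x - (x i - p - q * of_int (A i j)) \<odot> \<alpha> i - q \<odot> \<alpha> j"
  "s j (x - p \<odot> \<alpha> i - q \<odot> \<alpha> j) = x - p \<odot> \<alpha> i - (x j - q - p * of_int (A j i)) \<odot> \<alpha> j"
  by (auto simp: sref_def simple_root_def algebra_simps)

lemma s_cone:
  "s i (p \<odot> \<alpha> i + q \<odot> \<alpha> j) = (- p - q * of_int (A i j)) \<odot> \<alpha> i + q \<odot> \<alpha> j"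
  "s j (p \<odot> \<alpha> i + q \<odot> \<alpha> j) = p \<odot> \<alpha> i + (- q - p * of_int (A j i)) \<odot> \<alpha> j"
  by (auto simp: sref_def simple_root_def algebra_simps)

text \<open>Zero and unit coefficients are inserted so that \<open>s_plane\<close> and
  \<open>s_cone\<close> apply from the first letter on.\<close>

lemma plane_start: "x = x - 0 \<odot> \<alpha> i - 0 \<odot> \<alpha> j" "\<alpha> i = 1 \<odot> \<alpha> i + 0 \<odot> \<alpha> j"
  by auto

lemma ev_alt_word_Suc: "ev (alt_word a b (Suc k)) y = ev (alt_word b a k) (s a y)"
  by simp

lemma braid_step: "p = p' \<Longrightarrow> q = q' \<Longrightarrow> x - p \<odot> y - q \<odot> z = x - p' \<odot> y - q' \<odot> z"
  by simp

text \<open>In the cases used, \<open>m\<close> is the order of \<open>s i \<circ> s j\<close>,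
  namely 2, 3, 4 or 6; the second clause is positivity of roots in the dihedral subgroup.\<close>

definition braid :: "'i \<Rightarrow> 'i \<Rightarrow> nat \<Rightarrow> bool" where
  "braid i j m \<longleftrightarrow> ev (alt_word i j m) = ev (alt_word j i m) \<and>
    (\<forall>k<m. \<exists>p q. p \<ge> 0 \<and> q \<ge> 0 \<and> ev (alt_word j i k) (\<alpha> i) = p \<odot> \<alpha> i + q \<odot> \<alpha> j)"

text \<open>Both clauses are checked case by case, evaluating the words letter by letter on a
  generic point and on \<open>\<alpha> i\<close>.\<close>

lemma braidI:
  assumes "(A i j, A j i, m) \<in> {(0,0,2), (-1,-1,3), (-1,-2,4), (-2,-1,4), (-1,-3,6), (-3,-1,6)}"
  shows "braid i j m"
  unfolding braid_def
proof
  have num: "2 = Suc (Suc 0)" "3 = Suc (Suc (Suc 0))" "4 = Suc (Suc (Suc (Suc 0)))"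
    "6 = Suc (Suc (Suc (Suc (Suc (Suc 0)))))"
    by simp_all
  show "ev (alt_word i j m) = ev (alt_word j i m)"
  proof
    fix x
    have "ev (alt_word i j m) (x - 0 \<odot> \<alpha> i - 0 \<odot> \<alpha> j) = ev (alt_word j i m) (x - 0 \<odot> \<alpha> i - 0 \<odot> \<alpha> j)"
      using assms
      by (elim insertE emptyE Pair_inject; hypsubst)
        (simp only: num ev_alt_word_Suc alt_word.simps(1) word_eval_Nil id_apply s_plane, rule braid_step; simp)+
    then show "ev (alt_word i j m) x = ev (alt_word j i m) x"
      by (simp only: plane_start(1)[symmetric])
  qed
  have cone: "\<exists>p' q'. p' \<ge> 0 \<and> q' \<ge> 0 \<and> p \<odot> \<alpha> i + q \<odot> \<alpha> j = p' \<odot> \<alpha> i + q' \<odot> \<alpha> j"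
    if "p \<ge> 0" "q \<ge> 0" for p q
    using that by blast
  have "\<forall>k<m. \<exists>p q. p \<ge> 0 \<and> q \<ge> 0 \<and> ev (alt_word j i k) (1 \<odot> \<alpha> i + 0 \<odot> \<alpha> j) = p \<odot> \<alpha> i + q \<odot> \<alpha> j"
    using assms
    by (elim insertE emptyE Pair_inject; hypsubst)
      (simp only: num All_less_Suc not_less0 ev_alt_word_Suc alt_word.simps(1) word_eval_Nil id_apply s_cone,
        intro conjI allI impI cone; simp)+
  then show "\<forall>k<m. \<exists>p q. p \<ge> 0 \<and> q \<ge> 0 \<and> ev (alt_word j i k) (\<alpha> i) = p \<odot> \<alpha> i + q \<odot> \<alpha> j"
    by (simp only: plane_start(2)[symmetric])
qed

lemma braid_exists:
  assumes "i \<noteq> j"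
  shows "\<exists>m>0. braid i j m"
proof -
  define m :: nat where "m = (if A i j = 0 then 2 else if A i j * A j i = 1 then 3 else if A i j * A j i = 2 then 4 else 6)"
  have "(A i j, A j i, m) \<in> {(0,0,2), (-1,-1,3), (-1,-2,4), (-2,-1,4), (-1,-3,6), (-3,-1,6)}"
    using cartan_cases[OF assms] by (elim insertE emptyE) (simp_all add: m_def)
  then have "braid i j m" by (rule braidI)
  moreover have "m > 0" by (simp add: m_def)
  ultimately show ?thesis by blast
qed

lemma len_comp_s_le: "w \<in> W \<Longrightarrow> len (w \<circ> s i) \<le> Suc (len w)"
  using wlen_word_comp_le[of w A "[i]"] by simp

lemma comp_s_s [simp]: "w \<circ> s i \<circ> s i = w"
  by (simp add: comp_assoc)

text \<open>Splitting off the longest alternating suffix in \<^term>\<open>i\<close> and the last letter \<open>j\<close> of a reduced word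
  leaves an element without descents \<^term>\<open>i\<close> and \<open>j\<close>, which reduces the claim to rank two.\<close>
theorem nonneg_if_len_le:
  assumes "w \<in> W" "len w \<le> len (w \<circ> s i)"
  shows "nonneg (w (\<alpha> i))"
  using assms
proof (induction "len w" arbitrary: w i rule: less_induct)
  case less
  show ?case
  proof (cases "w = id")
    case False
    obtain us where us: "length us = len w" "ev us = w"
      using less.prems(1) by (rule reduced_word)
    with False obtain us' j where us': "us = us' @ [j]"
      by (metis rev_exhaust word_eval_Nil)
    define v0 where "v0 = ev us'"
    have v0: "w = v0 \<circ> s j" "v0 \<in> W" using us us' by (auto simp: v0_def)
    have "len v0 \<le> length us'" unfolding v0_def by (rule wlen_le)
    then have lv0: "len v0 + 1 = len w"
      using len_comp_s_le[OF v0(2), of j] us us' v0(1) by simp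
    have ij: "i \<noteq> j"
      using less.prems(2) lv0 v0(1) by auto
    \<comment> \<open>\<open>P k\<close> says that an alternating suffix of \<open>k\<close> letters
      splits off without loss of length; the largest such \<open>k\<close> is used.\<close>
    define P where "P k \<longleftrightarrow> (\<exists>v\<in>W. len v + k = len w \<and> w = v \<circ> ev (alt_word j i k))" for k
    define k where "k = (GREATEST k. P k)"
    have P1: "P 1" using v0 lv0 by (auto simp: P_def)
    have bd: "P k \<Longrightarrow> k \<le> len w" for k by (auto simp: P_def)
    have Pk: "P k" and k1: "k \<ge> 1"
      unfolding k_def using GreatestI_nat[of P, OF P1 bd] Greatest_le_nat[of P, OF P1 bd] by auto
    have nP: "\<not> P (Suc k)"
      using Greatest_le_nat[of P "Suc k" "len w"] bd unfolding k_def by fastforce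
    from Pk obtain v where v: "v \<in> W" "len v + k = len w" "w = v \<circ> ev (alt_word j i k)"
      by (auto simp: P_def)
    \<comment> \<open>The letter \<open>x\<close> starts the suffix, so a shorter
      \<open>v \<circ> s x\<close> would give too short a word for \<open>w\<close>;
      \<open>y\<close> would extend the suffix, against the maximality of \<open>k\<close>.\<close>
    have long: "len v \<le> len (v \<circ> s l)" if l: "l = i \<or> l = j" for l
    proof -
      obtain x y vs where x: "{x, y} = {j, i}" "alt_word j i k = x # vs"
        "alt_word j i (Suc k) = y # alt_word j i k"
        using alt_word_first[of k j i] k1 by auto
      have "length vs + 1 = k" using x(2) by (metis length_alt_word length_Cons Suc_eq_plus1)
      moreover have "len w \<le> len (v \<circ> s x) + length vs"
        using wlen_word_comp_le[of "v \<circ> s x" A vs] v x(2) by (auto simp: comp_assoc)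
      ultimately have "len v \<le> len (v \<circ> s x)" using v(2) by linarith
      moreover have "len v \<le> len (v \<circ> s y)"
      proof (rule ccontr)
        assume "\<not> len v \<le> len (v \<circ> s y)"
        then have "len v = Suc (len (v \<circ> s y))"
          using len_comp_s_le[of "v \<circ> s y" y] v(1) by (auto simp: weyl_comp)
        moreover have "w = (v \<circ> s y) \<circ> ev (alt_word j i (Suc k))"
          using v(3) unfolding x(3) by (simp add: comp_assoc)
        moreover have "v \<circ> s y \<in> W" using v(1) by blast
        ultimately have "P (Suc k)" using v(2) unfolding P_def by fastforce
        with nP show False by simp
      qed
      ultimately show ?thesis using l x(1) by (auto simp: doubleton_eq_iff)
    qed
    have "len v < len w" using v(2) k1 by linarith
    then have nn: "nonneg (v (\<alpha> i))" "nonneg (v (\<alpha> j))"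
      using less.hyps[of v] v(1) long by auto
    obtain m where m: "m > 0" "braid i j m" using braid_exists[OF ij] by blast
    \<comment> \<open>Otherwise the braid relation rewrites the suffix so that it ends in
      \<open>i\<close>, and \<open>w \<circ> s i\<close> would be shorter than
      \<open>w\<close>.\<close>
    have "k < m"
    proof (rule ccontr)
      assume "\<not> k < m"
      then obtain vs where vs: "alt_word j i k = vs @ alt_word j i m" "length vs = k - m"
        using alt_word_suffix[of m k j i] by auto
      obtain m' where m': "m = Suc m'" using m(1) by (cases m) auto
      have "ev (alt_word j i m) = ev (alt_word i j m)"
        using m(2) by (simp add: braid_def)
      then have "w = v \<circ> ev (vs @ alt_word j i m') \<circ> s i"
        using v(3) vs by (simp add: m' comp_assoc)
      then have "w \<circ> s i = v \<circ> ev (vs @ alt_word j i m')"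
        by simp
      then have "len (w \<circ> s i) \<le> len v + (k - m + m')"
        using wlen_word_comp_le[OF v(1), of "vs @ alt_word j i m'"] vs by simp
      then show False using less.prems(2) v(2) m' \<open>\<not> k < m\<close> by linarith
    qed
    then obtain p q where pq: "p \<ge> 0" "q \<ge> 0" "ev (alt_word j i k) (\<alpha> i) = p \<odot> \<alpha> i + q \<odot> \<alpha> j"
      using m(2) unfolding braid_def by blast
    then have "w (\<alpha> i) = p \<odot> v (\<alpha> i) + q \<odot> v (\<alpha> j)"
      using v by (simp only: comp_apply weyl_add weyl_smul)
    then show ?thesis
      using nn pq by (simp add: nonneg_combine)
  qed (simp add: nonneg_root)
qed

section \<open>Inverses, roots and inversion sets\<close>

lemma weyl_inverse:
  assumes "w \<in> W"
  shows "bij w" "inv w \<in> W" "w (inv w x) = x" "inv w (w x) = x"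
proof -
  have "\<exists>v\<in>W. v \<circ> w = id \<and> w \<circ> v = id"
    using assms
  proof (induction rule: weyl_induct)
    case (sref i w)
    then obtain v where v: "v \<in> W" "v \<circ> w = id" "w \<circ> v = id" by blast
    show ?case
    proof (intro bexI conjI)
      show "v \<circ> s i \<circ> (s i \<circ> w) = id" using v(2) by (simp add: comp_assoc)
      have "s i \<circ> w \<circ> (v \<circ> s i) = s i \<circ> (w \<circ> v) \<circ> s i" by (simp only: comp_assoc)
      then show "s i \<circ> w \<circ> (v \<circ> s i) = id" using v(3) by simp
    qed (use v in blast)
  qed (intro bexI[of _ id], auto)
  then obtain v where v: "v \<in> W" "v \<circ> w = id" "w \<circ> v = id" by blast
  then show "bij w" "inv w \<in> W"
    by (metis o_bij, metis inv_unique_comp)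
  then show "w (inv w x) = x" "inv w (w x) = x"
    by (simp_all add: bij_is_surj surj_f_inv_f bij_is_inj)
qed

lemma inv_s [simp]: "inv (s i) = s i"
  by (rule inv_unique_comp) simp_all

lemma inv_comp: "v \<in> W \<Longrightarrow> w \<in> W \<Longrightarrow> inv (v \<circ> w) = inv w \<circ> inv v"
  by (simp add: o_inv_distrib weyl_inverse)

lemma inv_s_comp: "w \<in> W \<Longrightarrow> inv (s i \<circ> w) = inv w \<circ> s i"
  by (simp add: inv_comp)

lemma ip_inv: "w \<in> W \<Longrightarrow> \<langle>inv w x, y\<rangle> = \<langle>x, w y\<rangle>"
  using ip_W[of "inv w" x "w y"] weyl_inverse[of w] by simp

lemma len_inv_le: "w \<in> W \<Longrightarrow> len (inv w) \<le> len w"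
proof -
  assume w: "w \<in> W"
  have ev: "inv (ev us) = ev (rev us)" for us
  proof (induction us)
    case (Cons a us)
    have "inv (ev (a # us)) = inv (ev us) \<circ> s a" using inv_s_comp[OF weylI] by simp
    then show ?case by (simp only: Cons.IH rev.simps word_eval_append word_eval_Cons word_eval_Nil comp_id)
  qed (simp add: inv_unique_comp)
  obtain us where "length us = len w" "ev us = w"
    using w by (rule reduced_word)
  then show ?thesis
    using wlen_le[of A "rev us"] ev[of us] by simp
qed

lemma len_inv: "w \<in> W \<Longrightarrow> len (inv w) = len w"
  by (metis len_inv_le inv_inv_eq weyl_inverse(1,2) antisym)

definition roots :: "('i \<Rightarrow> real) set" where
  "roots = {w (\<alpha> i) | w i. w \<in> W}"

lemma rootsI: "w \<in> W \<Longrightarrow> w (\<alpha> i) \<in> roots"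
  by (auto simp: roots_def)

lemma simple_root_in_roots [intro, simp]: "\<alpha> i \<in> roots"
  using rootsI[of id i] by simp

lemma weyl_roots: "w \<in> W \<Longrightarrow> \<beta> \<in> roots \<Longrightarrow> w \<beta> \<in> roots"
  unfolding roots_def by clarsimp (metis comp_apply weyl_comp)

lemma root_nonzero: "\<beta> \<in> roots \<Longrightarrow> \<beta> \<noteq> 0"
proof
  assume "\<beta> \<in> roots" "\<beta> = 0"
  then obtain w i where w: "w \<in> W" "\<beta> = w (\<alpha> i)" by (auto simp: roots_def)
  with \<open>\<beta> = 0\<close> have "\<langle>\<alpha> i, \<alpha> i\<rangle> = 0"
    using ip_W[OF w(1), of "\<alpha> i" "\<alpha> i"] by (metis ip_zero_iff)
  then show False using D_pos[of i] by (simp add: D_def)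
qed

text \<open>Apply \<open>nonneg_if_len_le\<close> to \<open>w\<close> and to
  \<open>w \<circ> s i\<close>. Equal lengths would put the nonzero vector
  \<open>w (\<alpha> i)\<close> and its negative into the same pointed cone.\<close>

lemma nonneg_if_not_descent:
  assumes "w \<in> W"
  shows "nonneg (w (\<alpha> i)) \<longleftrightarrow> len w < len (w \<circ> s i)"
    "nonneg (- w (\<alpha> i)) \<longleftrightarrow> len (w \<circ> s i) < len w"
proof -
  have ws: "w \<circ> s i \<in> W" using assms by blast
  have 1: "len w \<le> len (w \<circ> s i) \<Longrightarrow> nonneg (w (\<alpha> i))"
    using nonneg_if_len_le[OF assms] .
  have 2: "len (w \<circ> s i) \<le> len w \<Longrightarrow> nonneg (- w (\<alpha> i))"
    using nonneg_if_len_le[OF ws, of i] weyl_minus[OF assms] by simp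
  have 3: "\<not> (nonneg (w (\<alpha> i)) \<and> nonneg (- w (\<alpha> i)))"
    using nonneg_antisym root_nonzero[OF rootsI[OF assms]] by blast
  show "nonneg (w (\<alpha> i)) \<longleftrightarrow> len w < len (w \<circ> s i)"
    "nonneg (- w (\<alpha> i)) \<longleftrightarrow> len (w \<circ> s i) < len w"
    using 1 2 3 by linarith+
qed

lemma root_coherent: "\<beta> \<in> roots \<Longrightarrow> nonneg (- \<beta>) \<longleftrightarrow> \<not> nonneg \<beta>"
proof -
  assume "\<beta> \<in> roots"
  then obtain w i where w: "w \<in> W" "\<beta> = w (\<alpha> i)" by (auto simp: roots_def)
  have "nonneg \<beta> \<or> nonneg (- \<beta>)"
    using nonneg_if_not_descent[OF w(1), of i] nonneg_if_len_le[OF w(1), of i] unfolding w(2) by linarith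
  moreover have "\<not> (nonneg \<beta> \<and> nonneg (- \<beta>))"
    using nonneg_antisym root_nonzero[OF \<open>\<beta> \<in> roots\<close>] by blast
  ultimately show ?thesis by blast
qed

lemma len_s_comp:
  assumes "w \<in> W"
  shows "nonneg (inv w (\<alpha> i)) \<longleftrightarrow> len w < len (s i \<circ> w)"
    "nonneg (- inv w (\<alpha> i)) \<longleftrightarrow> len (s i \<circ> w) < len w"
proof -
  have "len (s i \<circ> w) = len (inv w \<circ> s i)"
    using len_inv[of "s i \<circ> w"] assms by (simp add: inv_s_comp weyl_comp)
  then show "nonneg (inv w (\<alpha> i)) \<longleftrightarrow> len w < len (s i \<circ> w)"
    "nonneg (- inv w (\<alpha> i)) \<longleftrightarrow> len (s i \<circ> w) < len w"
    using nonneg_if_not_descent[of "inv w" i] assms by (simp_all add: weyl_inverse len_inv)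
qed

lemma len_s_comp_Suc:
  assumes "w \<in> W" "len w < len (s i \<circ> w)"
  shows "len (s i \<circ> w) = Suc (len w)"
  using wlen_comp_le[of "s i" A w] wlen_le[of A "[i]"] assms by simp

lemma cf_int: "\<beta> \<in> roots \<Longrightarrow> cf i \<beta> \<in> \<int>"
proof -
  assume "\<beta> \<in> roots"
  then obtain w j where w: "w \<in> W" "\<beta> = w (\<alpha> j)" by (auto simp: roots_def)
  have "\<forall>i. cf i (w (\<alpha> j)) \<in> \<int>"
    using w(1)
  proof (induction rule: weyl_induct)
    case (sref k w)
    have "(w (\<alpha> j)) k \<in> \<int>"
      unfolding coord_cf[of _ k] using sref by (intro Ints_sum Ints_mult) auto
    then show ?case using sref by (simp add: cf_s)
  qed (simp add: cf_root)
  then show ?thesis using w by simp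
qed

text \<open>Only the coefficient at \<open>i\<close> changes under \<open>s i\<close>, so a change
  of sign forces \<open>\<beta>\<close> onto the ray of \<open>\<alpha> i\<close>. The factor is a
  unit among the integers, hence 1.\<close>

lemma s_nonneg:
  assumes "\<beta> \<in> roots" "nonneg \<beta>" "\<beta> \<noteq> \<alpha> i"
  shows "nonneg (s i \<beta>)"
proof (rule ccontr)
  assume "\<not> nonneg (s i \<beta>)"
  then have neg: "nonneg (- s i \<beta>)"
    using assms(1) root_coherent[of "s i \<beta>"] weyl_roots[OF sref_in_weyl] by blast
  have 0: "cf k \<beta> = 0" if "k \<noteq> i" for k
  proof -
    have "0 \<le> cf k (- s i \<beta>)" "0 \<le> cf k \<beta>"
      using neg assms(2) by (simp_all only: nonneg_def)
    then show ?thesis using that by (simp add: cf_linear cf_s)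
  qed
  have \<beta>: "\<beta> = cf i \<beta> \<odot> \<alpha> i"
    by (rule cf_eqI) (auto simp: cf_linear cf_root 0)
  obtain w j where w: "w \<in> W" "\<beta> = w (\<alpha> j)"
    using assms(1) by (auto simp: roots_def)
  \<comment> \<open>Moving \<open>\<beta>\<close> back to a simple root produces an integral inverse
    of the factor \<open>cf i \<beta>\<close>.\<close>
  have "\<alpha> j = inv w \<beta>" using w by (simp add: weyl_inverse)
  also have "\<dots> = cf i \<beta> \<odot> inv w (\<alpha> i)"
    by (subst \<beta>) (rule weyl_smul[OF weyl_inverse(2)[OF w(1)]])
  finally have "cf j (\<alpha> j) = cf i \<beta> * cf j (inv w (\<alpha> i))"
    by (metis cf_linear(4))
  then have 1: "cf i \<beta> * cf j (inv w (\<alpha> i)) = 1" by (simp add: cf_root)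
  obtain a b where ab: "cf i \<beta> = of_int a" "cf j (inv w (\<alpha> i)) = of_int b"
    using cf_int[OF assms(1)] cf_int[OF rootsI[OF weyl_inverse(2)[OF w(1)]]] by (metis Ints_cases)
  have "a * b = 1" using 1 unfolding ab by (metis of_int_eq_1_iff of_int_mult)
  moreover have "a \<ge> 0" using assms(2) ab unfolding nonneg_def by (metis of_int_0_le_iff)
  ultimately have "a = 1" using zmult_eq_1_iff[of a b] by auto
  then have "\<beta> = \<alpha> i" by (subst \<beta>) (auto simp: ab)
  with assms(3) show False by simp
qed

text \<open>Left inversions: \<open>inv w\<close> rather than \<open>w\<close> is applied, so that
  the simple roots among them are the left descents.\<close>

definition inversions :: "(('i \<Rightarrow> real) \<Rightarrow> ('i \<Rightarrow> real)) \<Rightarrow> ('i \<Rightarrow> real) set" where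
  "inversions w = {\<beta> \<in> roots. nonneg \<beta> \<and> \<not> nonneg (inv w \<beta>)}"

lemma inversions_id [simp]: "inversions id = {}"
  by (auto simp: inversions_def)

lemma simple_inversion:
  assumes "w \<in> W"
  shows "\<alpha> i \<in> inversions w \<longleftrightarrow> len (s i \<circ> w) < len w"
    "\<alpha> i \<notin> inversions w \<longleftrightarrow> len w < len (s i \<circ> w)"
  using len_s_comp[OF assms, of i] root_coherent[OF rootsI[OF weyl_inverse(2)[OF assms]], of i]
  by (auto simp: inversions_def nonneg_root)

lemma inversions_s_comp:
  assumes "w \<in> W" "nonneg \<beta>" "\<beta> \<noteq> \<alpha> i"
  shows "\<beta> \<in> inversions (s i \<circ> w) \<longleftrightarrow> s i \<beta> \<in> inversions w"
proof -
  have "\<beta> \<in> roots \<longleftrightarrow> s i \<beta> \<in> roots"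
    by (metis s_s sref_in_weyl weyl_roots)
  with assms s_nonneg[of \<beta> i] show ?thesis
    by (auto simp: inversions_def inv_s_comp[OF assms(1)])
qed

lemma weyl_left_induct [consumes 1, case_names id sref]:
  assumes "w \<in> W" "P id"
    and step: "\<And>i w. w \<in> W \<Longrightarrow> len w < len (s i \<circ> w) \<Longrightarrow> P w \<Longrightarrow> P (s i \<circ> w)"
  shows "P w"
  using assms(1)
proof (induction "len w" arbitrary: w)
  case 0
  then show ?case using wlen_0 assms(2) by metis
next
  case (Suc n)
  obtain us where us: "length us = len w" "ev us = w"
    using Suc.prems by (rule reduced_word)
  with Suc.hyps(2) obtain i vs where vs: "us = i # vs" by (cases us) auto
  have w: "w = s i \<circ> ev vs" using us vs by simp
  have "len (ev vs) \<le> n" using wlen_le[of A vs] us vs Suc.hyps(2) by simp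
  moreover have "Suc n \<le> Suc (len (ev vs))"
    using wlen_comp_le[of "s i" A "ev vs"] wlen_le[of A "[i]"] w Suc.hyps(2) by (auto simp: weylI)
  ultimately have "n = len (ev vs)" by simp
  then show ?case
    using step[OF weylI, of vs i] Suc.hyps w weylI[of A vs] by simp
qed

lemma no_descent_id:
  assumes "w \<in> W" "\<And>i. nonneg (w (\<alpha> i))"
  shows "w = id"
proof (rule ccontr)
  assume "w \<noteq> id"
  obtain us where us: "length us = len w" "ev us = w"
    using assms(1) by (rule reduced_word)
  with \<open>w \<noteq> id\<close> obtain vs i where vs: "us = vs @ [i]"
    by (metis rev_exhaust word_eval_Nil)
  have "w \<circ> s i = ev vs" using us vs by auto
  then have "len (w \<circ> s i) < len w"
    using wlen_le[of A vs] us vs by simp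
  with nonneg_if_not_descent(1)[OF assms(1), of i] assms(2)[of i] show False by simp
qed

section \<open>Inversions and stabilizers of fundamental weights\<close>

lemma cf_inv_omega:
  assumes "w \<in> W" "w (omega i) = omega i"
  shows "cf i (inv w x) = cf i x"
  using assms by (simp add: cf_def ip_inv)

text \<open>\<open>inv w\<close> preserves the coefficient at \<open>i\<close>; it is nonnegative
  before and nonpositive after, hence zero. Fixing \<open>omega i\<close> stands for lying in the
  parabolic subgroup without \<open>s i\<close>.\<close>

lemma inversion_support:
  assumes "w \<in> W" "w (omega i) = omega i" "\<beta> \<in> inversions w"
  shows "cf i \<beta> = 0"
proof -
  have "\<not> nonneg (inv w \<beta>)" "nonneg \<beta>" "\<beta> \<in> roots"
    using assms(3) by (auto simp: inversions_def)
  then have "nonneg (- inv w \<beta>)"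
    using root_coherent weyl_roots[OF weyl_inverse(2)[OF assms(1)]] by blast
  then have "0 \<le> cf i (- inv w \<beta>)" "0 \<le> cf i \<beta>"
    using \<open>nonneg \<beta>\<close> by (simp_all only: nonneg_def)
  then show ?thesis
    using cf_inv_omega[OF assms(1,2)] by (simp add: cf_linear)
qed

lemma fixes_omega_not_descent:
  assumes "w \<in> W" "w (omega i) = omega i"
  shows "\<alpha> i \<notin> inversions w"
  using inversion_support[OF assms, of "\<alpha> i"] by (auto simp: cf_root)

lemma inversions_subset:
  assumes "w \<in> W" "len w < len (s i \<circ> w)" "\<beta> \<in> inversions w"
  shows "s i \<beta> \<in> inversions (s i \<circ> w)"
proof -
  have b: "\<beta> \<in> roots" "nonneg \<beta>" using assms(3) by (auto simp: inversions_def)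
  have ne: "\<beta> \<noteq> \<alpha> i" using assms simple_inversion(2) by blast
  have nn: "nonneg (s i \<beta>)" by (rule s_nonneg[OF b ne])
  have "s i \<beta> \<noteq> \<alpha> i"
  proof
    assume "s i \<beta> = \<alpha> i"
    then have "\<beta> = - \<alpha> i" by (metis s_root s_s)
    with b(2) show False
      using root_coherent[OF simple_root_in_roots, of i] by (simp add: nonneg_root)
  qed
  then show ?thesis
    using inversions_s_comp[OF assms(1) nn] assms(3) by simp
qed

text \<open>The converse of \<open>inversion_support\<close>: each letter added on the left is a
  simple inversion, so it differs from \<open>i\<close>.\<close>

lemma fixes_omega:
  assumes "w \<in> W" "\<And>\<beta>. \<beta> \<in> inversions w \<Longrightarrow> cf i \<beta> = 0"
  shows "w (omega i) = omega i"
  using assms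
proof (induction rule: weyl_left_induct)
  case (sref j w)
  have jw: "\<alpha> j \<in> inversions (s j \<circ> w)"
    using simple_inversion(1)[of "s j \<circ> w" j] sref(1,2) by (simp add: weyl_comp)
  then have ij: "i \<noteq> j" using sref.prems[OF jw] by (auto simp: cf_root)
  have "cf i \<beta> = 0" if "\<beta> \<in> inversions w" for \<beta>
    using sref.prems[OF inversions_subset[OF sref(1,2) that]] ij by (simp add: cf_s)
  then have "w (omega i) = omega i" by (rule sref.IH)
  then show ?case using ij by (simp add: sref_omega)
qed simp

lemma cf_sum: "cf i (\<Sum>k\<in>S. f k) = (\<Sum>k\<in>S. cf i (f k))"
proof (induction S rule: infinite_finite_induct)
  case (insert x F)
  then show ?case by (simp only: sum.insert[OF insert(1,2)] cf_linear)
qed (simp_all add: cf_def ip_def)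

lemma root_basis: "x = (\<Sum>k\<in>UNIV. cf k x \<odot> \<alpha> k)"
  by (rule cf_eqI) (simp add: cf_sum cf_linear cf_root if_distrib cong: if_cong)

section \<open>The longest element\<close>

abbreviation "w0 \<equiv> longest A"

lemma longest: "w0 \<in> W" "v \<in> W \<Longrightarrow> len v \<le> len w0"
proof -
  have "\<exists>w. w \<in> W \<and> (\<forall>v\<in>W. len v \<le> len w)"
  proof -
    have fin: "finite (len ` W)" "len ` W \<noteq> {}" using finite_W by auto
    obtain w where "w \<in> W" "Max (len ` W) = len w"
      using Max_in[OF fin] by blast
    then show ?thesis using Max_ge[OF fin(1)] by (metis imageI)
  qed
  then have "w0 \<in> W \<and> (\<forall>v\<in>W. len v \<le> len w0)"
    unfolding longest_def by (rule someI_ex)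
  then show "w0 \<in> W" "v \<in> W \<Longrightarrow> len v \<le> len w0" by auto
qed

lemma w0_root: "nonneg (- w0 (\<alpha> i))"
proof -
  have "\<not> len w0 < len (w0 \<circ> s i)"
    using longest(2)[of "w0 \<circ> s i"] longest(1) by (simp add: weyl_comp leD)
  then show ?thesis
    using nonneg_if_not_descent(1)[OF longest(1)] root_coherent[OF rootsI[OF longest(1)]] by blast
qed

lemma w0_nonneg:
  assumes "nonneg x"
  shows "nonneg (- w0 x)"
proof -
  have "w0 (\<Sum>k\<in>UNIV. cf k x \<odot> \<alpha> k) = (\<Sum>k\<in>UNIV. cf k x \<odot> w0 (\<alpha> k))"
    by (simp add: weyl_sum[OF longest(1)] weyl_smul[OF longest(1)])
  then have w0x: "w0 x = (\<Sum>k\<in>UNIV. cf k x \<odot> w0 (\<alpha> k))"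
    using root_basis[of x] by simp
  show ?thesis
    unfolding nonneg_def
  proof
    fix i
    have "cf i (- w0 x) = (\<Sum>k\<in>UNIV. cf k x * cf i (- w0 (\<alpha> k)))"
      unfolding w0x by (simp add: cf_linear cf_sum sum_negf)
    also have "\<dots> \<ge> 0"
      using assms w0_root by (intro sum_nonneg mult_nonneg_nonneg) (simp_all only: nonneg_def)
    finally show "0 \<le> cf i (- w0 x)" .
  qed
qed

lemma w0_flip:
  assumes "\<beta> \<in> roots"
  shows "nonneg (w0 \<beta>) \<longleftrightarrow> \<not> nonneg \<beta>"
proof
  have r: "w0 \<beta> \<in> roots" by (rule weyl_roots[OF longest(1) assms])
  show "\<not> nonneg \<beta>" if "nonneg (w0 \<beta>)"
    using that w0_nonneg root_coherent[OF r] by blast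
  show "nonneg (w0 \<beta>)" if "\<not> nonneg \<beta>"
  proof -
    have "nonneg (- \<beta>)" using that root_coherent[OF assms] by simp
    then have "nonneg (- w0 (- \<beta>))" by (rule w0_nonneg)
    then show ?thesis using weyl_minus[OF longest(1)] by simp
  qed
qed

lemma w0_w0: "w0 \<circ> w0 = id" "w0 (w0 x) = x"
proof -
  show "w0 \<circ> w0 = id"
  proof (rule no_descent_id)
    show "w0 \<circ> w0 \<in> W" using longest(1) by blast
    show "nonneg ((w0 \<circ> w0) (\<alpha> i))" for i
      using w0_flip[OF rootsI[OF longest(1)]] w0_flip[OF simple_root_in_roots, of i] by (simp add: nonneg_root)
  qed
  then show "w0 (w0 x) = x" by (metis comp_apply id_apply)
qed

lemma inv_w0 [simp]: "inv w0 = w0"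
  by (rule inv_unique_comp) (simp_all add: w0_w0)

text \<open>\<open>w0\<close> exchanges positive and negative roots. This turns antisortability into
  a condition on the complement of \<open>inversions w\<close>.\<close>

lemma inversions_comp_w0:
  assumes "w \<in> W"
  shows "inversions (w \<circ> w0) = {\<beta> \<in> roots. nonneg \<beta>} - inversions w"
  using w0_flip[OF weyl_roots[OF weyl_inverse(2)[OF assms]]]
  by (auto simp: inversions_def inv_comp[OF assms longest(1)])

lemma inversions_w0: "inversions w0 = {\<beta> \<in> roots. nonneg \<beta>}"
  using inversions_comp_w0[of id] by simp

text \<open>Coordinates are scaled pairings with simple roots, and \<open>w0\<close>, being its own
  inverse, moves across the form onto them.\<close>

lemma w0_omega_nonpos: "(- w0 (omega i)) k \<ge> 0"
proof -
  have "(- w0 (omega i)) k * D k = \<langle>- w0 (omega i), \<alpha> k\<rangle>"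
    by (rule ip_root[symmetric])
  also have "\<dots> = \<langle>- w0 (\<alpha> k), omega i\<rangle>"
    using ip_inv[OF longest(1), of "omega i" "\<alpha> k"] by (simp add: ip_linear ip_sym[of "omega i"])
  also have "\<dots> = cf i (- w0 (\<alpha> k)) * D i"
    using D_pos[of i] by (simp add: cf_def)
  also have "\<dots> \<ge> 0"
  proof (rule mult_nonneg_nonneg)
    show "cf i (- w0 (\<alpha> k)) \<ge> 0" using w0_root by (simp only: nonneg_def)
  qed (use D_pos[of i] in simp)
  finally show ?thesis using D_pos[of k] by (simp only: zero_le_mult_iff) auto
qed

lemma omega_orbit_int: "w \<in> W \<Longrightarrow> \<forall>k. w (omega i) k \<in> \<int>"
  by (induction rule: weyl_induct) (auto simp: sref_def omega_apply)

text \<open>The matrix of \<open>- w\<^sub>0\<close> on the fundamental weights is a nonnegative integer involution, hence a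
  permutation matrix.\<close>
lemma w0_omega: "- w0 (omega i) = omega (istar A i)"
proof -
  define M where "M k j = (- w0 (omega j)) k" for k j
  have M0: "M k j \<ge> 0" for k j unfolding M_def by (rule w0_omega_nonpos)
  have M1: "M k j \<ge> 1" if "M k j \<noteq> 0" for k j
  proof -
    have "M k j \<in> \<int>" using omega_orbit_int[OF longest(1), of j] by (simp add: M_def)
    then obtain n where "M k j = of_int n" by (rule Ints_cases)
    then show ?thesis using that M0[of k j] by simp
  qed
  have col: "\<exists>l. M l k \<noteq> 0" for k
  proof (rule ccontr)
    assume "\<not> ?thesis"
    then have "w0 (omega k) = 0" by (auto simp: M_def)
    then have "omega k = 0" using w0_w0(2)[of "omega k"] weyl_zero[OF longest(1)] by metis
    then show False by (metis omega_apply zero_fun_apply zero_neq_one)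
  qed
  \<comment> \<open>\<open>M\<close> squares to the identity, because \<open>w0\<close>
    does.\<close>
  have sq: "(\<Sum>k\<in>UNIV. M k i * M l k) = (if l = i then 1 else 0)" for l
  proof -
    have "omega i = w0 (\<Sum>k\<in>UNIV. w0 (omega i) k \<odot> omega k)"
      using w0_w0(2) omega_basis by metis
    also have "\<dots> = (\<Sum>k\<in>UNIV. w0 (omega i) k \<odot> w0 (omega k))"
      by (simp add: weyl_sum[OF longest(1)] weyl_smul[OF longest(1)])
    finally have "omega i l = (\<Sum>k\<in>UNIV. w0 (omega i) k \<odot> w0 (omega k)) l" by simp
    then show ?thesis by (simp add: sum_fun_apply M_def omega_apply)
  qed
  have z: "M k i * M l k = 0" if "l \<noteq> i" for k l
  proof -
    have "(\<Sum>k\<in>UNIV. M k i * M l k) = 0" using sq[of l] that by simp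
    then show ?thesis using M0 by (subst (asm) sum_nonneg_eq_0_iff) auto
  qed
  have "\<exists>k. M k i * M i k \<noteq> 0"
    using sq[of i] by (metis (mono_tags, lifting) sum.neutral zero_neq_one)
  then obtain k where k: "M k i \<noteq> 0" "M i k \<noteq> 0" by auto
  have prod1: "M k i * M i k \<ge> 1" using M1[OF k(1)] M1[OF k(2)] mult_mono[of 1 "M k i" 1 "M i k"] by simp
  have rest: "(\<Sum>j\<in>UNIV. M j i * M i j) = M k i * M i k + (\<Sum>j\<in>UNIV - {k}. M j i * M i j)"
    by (rule sum.remove) auto
  have "(\<Sum>j\<in>UNIV - {k}. M j i * M i j) \<ge> 0"
    using M0 by (intro sum_nonneg) auto
  with rest prod1 sq[of i] have rest0: "(\<Sum>j\<in>UNIV - {k}. M j i * M i j) = 0" and one: "M k i * M i k = 1"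
    by auto
  have "M k i = 1"
  proof -
    have "M k i * 1 \<le> M k i * M i k" using M1[OF k(2)] M0 by (intro mult_left_mono)
    then show ?thesis using one M1[OF k(1)] by simp
  qed
  \<comment> \<open>A second nonzero entry in column \<open>i\<close>, in row \<open>j\<close>,
    would force column \<open>j\<close> to vanish entirely, contrary to \<open>col\<close>.\<close>
  moreover have "M j i = 0" if "j \<noteq> k" for j
  proof (rule ccontr)
    assume nz: "M j i \<noteq> 0"
    have "M j i * M i j = 0"
      using rest0 M0 that by (subst (asm) sum_nonneg_eq_0_iff) auto
    with nz z have "M l j = 0" for l by (cases "l = i") auto
    then show False using col by blast
  qed
  ultimately have "- w0 (omega i) = omega k"
    by (auto simp: M_def omega_apply fun_eq_iff)
  moreover have "istar A i = k"
    unfolding istar_def using calculation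
    by (intro the_equality) (auto simp: fun_Compl_def)
  ultimately show ?thesis by simp
qed

section \<open>The Euler form and sortable elements\<close>

abbreviation K :: "'i \<Rightarrow> 'i \<Rightarrow> real" where "K i j \<equiv> \<langle>\<alpha> i, \<alpha> j\<rangle>"

text \<open>The form is half the inner product on the diagonal and, off the diagonal, counts the pair of
  \<open>\<alpha>\<^sub>i\<close> and \<open>\<alpha>\<^sub>j\<close> only if \<open>i\<close> precedes \<open>j\<close> in the list.\<close>
fun euler :: "'i list \<Rightarrow> ('i \<Rightarrow> real) \<Rightarrow> ('i \<Rightarrow> real) \<Rightarrow> real" where
  "euler [] x y = 0"
| "euler (t # d) x y = cf t x * (D t * cf t y + (\<Sum>j\<leftarrow>d. K t j * cf j y)) + euler d x y"

text \<open>The recursion peels letters from the front; after a rotation the letter of interest sits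
  at the back.\<close>

lemma euler_snoc:
  "euler (d @ [t]) x y = euler d x y + (D t * cf t x + (\<Sum>i\<leftarrow>d. K i t * cf i x)) * cf t y"
  by (induction d) (simp_all add: algebra_simps)

lemma euler_cong:
  assumes "\<And>i. i \<in> set d \<Longrightarrow> cf i x = cf i x' \<and> cf i y = cf i y'"
  shows "euler d x y = euler d x' y'"
  using assms
proof (induction d)
  case (Cons t d)
  have "(\<Sum>j\<leftarrow>d. K t j * cf j y) = (\<Sum>j\<leftarrow>d. K t j * cf j y')"
    using Cons.prems by (intro arg_cong[where f = sum_list] map_cong) auto
  then show ?case using Cons by simp
qed simp

lemma euler_zero_right: "(\<And>i. i \<in> set d \<Longrightarrow> cf i y = 0) \<Longrightarrow> euler d x y = 0"
proof (induction d)
  case (Cons t d)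
  have "(\<Sum>j\<leftarrow>d. K t j * cf j y) = (\<Sum>j\<leftarrow>d. 0)"
    using Cons.prems by (intro arg_cong[where f = sum_list] map_cong) auto
  then show ?case using Cons by simp
qed simp

lemma euler_zero_left: "(\<And>i. i \<in> set d \<Longrightarrow> cf i x = 0) \<Longrightarrow> euler d x y = 0"
  by (induction d) simp_all

lemma euler_minus_right: "euler d x (- y) = - euler d x y"
proof -
  have "euler d x z = - euler d x y" if z: "\<And>i. cf i z = - cf i y" for z
  proof (induction d)
    case (Cons t d)
    have "(\<Sum>j\<leftarrow>d. K t j * cf j z) = - (\<Sum>j\<leftarrow>d. K t j * cf j y)"
      by (induction d) (simp_all add: z)
    then show ?case using Cons z[of t] by (simp add: algebra_simps)
  qed simp
  then show ?thesis using cf_linear(3) by blast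
qed

text \<open>The Gram matrix has diagonal entry \<open>2 * D t\<close>, and the support condition
  restricts the full sum to the listed letters.\<close>

lemma coord_support:
  assumes "distinct (t # d)" "\<And>i. i \<notin> set (t # d) \<Longrightarrow> cf i x = 0"
  shows "x t * D t = 2 * D t * cf t x + (\<Sum>i\<leftarrow>d. K i t * cf i x)"
proof -
  have "x t * D t = (\<Sum>i\<in>UNIV. K i t * cf i x)"
    unfolding coord_cf[of x t] sum_distrib_right
    by (intro sum.cong) (simp_all add: ip_root_root mult_ac)
  also have "\<dots> = (\<Sum>i\<in>set (t # d). K i t * cf i x)"
    using assms(2) by (intro sum.mono_neutral_right) auto
  also have "\<dots> = (\<Sum>i\<leftarrow>t # d. K i t * cf i x)"
    using assms(1) by (simp add: sum_list_distinct_conv_sum_set del: list.map sum_list.Cons set_simps)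
  also have "\<dots> = 2 * D t * cf t x + (\<Sum>i\<leftarrow>d. K i t * cf i x)"
    by (simp add: ip_root_root)
  finally show ?thesis .
qed

text \<open>\<open>s t\<close> changes only the coefficient at \<open>t\<close>. By \<open>X\<close>
  and \<open>Y\<close> the new coefficient, scaled by \<open>D t\<close>, is minus the bracket that
  \<open>euler_snoc\<close> respectively \<open>euler\<close> attaches to \<open>t\<close>, so one
  form is carried to the other.\<close>

lemma euler_rotate:
  assumes "distinct (t # d)"
    and "\<And>i. i \<notin> set (t # d) \<Longrightarrow> cf i x = 0" "\<And>i. i \<notin> set (t # d) \<Longrightarrow> cf i y = 0"
  shows "euler (t # d) (s t x) (s t y) = euler (d @ [t]) x y"
proof -
  have cf_t: "cf i (s t z) = cf i z" if "i \<in> set d" for i z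
    using that assms(1) by (auto simp: cf_s)
  have X: "D t * cf t (s t x) = - (D t * cf t x + (\<Sum>i\<leftarrow>d. K i t * cf i x))"
    using coord_support[OF assms(1,2)] by (simp add: cf_s algebra_simps)
  have Y: "D t * cf t (s t y) = - (D t * cf t y + (\<Sum>i\<leftarrow>d. K t i * cf i y))"
    using coord_support[OF assms(1,3)] by (simp add: cf_s algebra_simps ip_sym[of "\<alpha> t"])
  have sum: "(\<Sum>j\<leftarrow>d. K t j * cf j (s t y)) = (\<Sum>j\<leftarrow>d. K t j * cf j y)"
    using cf_t by (intro arg_cong[where f = sum_list] map_cong) auto
  have "euler (t # d) (s t x) (s t y) = cf t (s t x) * (D t * cf t (s t y) + (\<Sum>j\<leftarrow>d. K t j * cf j y)) + euler d x y"
    using euler_cong[of d "s t x" x "s t y" y] cf_t sum by simp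
  also have "\<dots> = - (D t * cf t (s t x)) * cf t y + euler d x y"
    unfolding Y by (simp add: algebra_simps)
  also have "\<dots> = euler (d @ [t]) x y"
    unfolding X euler_snoc by (simp add: algebra_simps)
  finally show ?thesis .
qed

lemma euler_root_first:
  assumes "t \<notin> set d"
  shows "euler (t # d) x (\<alpha> t) = D t * cf t x"
proof -
  have "(\<Sum>j\<leftarrow>d. K t j * cf j (\<alpha> t)) = (\<Sum>j\<leftarrow>d. 0)"
    using assms by (intro arg_cong[where f = sum_list] map_cong) (auto simp: cf_root)
  moreover have "euler d x (\<alpha> t) = 0"
    using assms by (intro euler_zero_right) (auto simp: cf_root)
  ultimately show ?thesis by (simp add: cf_root)
qed

text \<open>Distinct simple roots pair nonpositively. With \<open>euler_root_first\<close> this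
  bounds the form at \<open>\<alpha> t\<close> and \<open>y\<close> by its value with the arguments
  exchanged.\<close>

lemma euler_first_root_le:
  assumes "t \<notin> set d" "nonneg y"
  shows "euler (t # d) (\<alpha> t) y \<le> D t * cf t y"
proof -
  have "K t j * cf j y \<le> 0" if "j \<in> set d" for j
  proof -
    have "K t j \<le> 0"
      using that assms(1) A_off[of j t] D_pos[of t] D_pos[of j]
      by (subst ip_root_root) (metis less_imp_le mult_nonpos_nonneg of_int_le_0_iff)
    then show ?thesis using assms(2) by (simp add: nonneg_def mult_nonpos_nonneg)
  qed
  then have "(\<Sum>j\<leftarrow>d. K t j * cf j y) \<le> 0" by (intro sum_list_nonpos) auto
  moreover have "euler d (\<alpha> t) y = 0"
    using assms by (intro euler_zero_left) (auto simp: cf_root)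
  ultimately show ?thesis by (simp add: cf_root)
qed

text \<open>The list holds the letters that are still available, in the cyclic order in which they are
  read next. Skipping a letter discards it for good, which is the nestedness of the \<open>c\<close>-factorization.\<close>
inductive sortable :: "'i list \<Rightarrow> (('i \<Rightarrow> real) \<Rightarrow> ('i \<Rightarrow> real)) \<Rightarrow> bool" where
  base: "sortable [] id"
| skip: "sortable d w \<Longrightarrow> sortable (t # d) w"
| take: "sortable (d @ [t]) w \<Longrightarrow> len w < len (s t \<circ> w) \<Longrightarrow> sortable (t # d) (s t \<circ> w)"

lemma sortable_id [simp]: "sortable d id"
  by (induction d) (rule sortable.base, rule sortable.skip)

lemma sortable_weyl: "sortable d w \<Longrightarrow> w \<in> W"
  by (induction rule: sortable.induct) (blast intro: id_in_weyl sref_in_weyl weyl_comp)+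

lemma sortable_fixes: "sortable d w \<Longrightarrow> i \<notin> set d \<Longrightarrow> w (omega i) = omega i"
  by (induction rule: sortable.induct) (auto simp: sref_omega)

text \<open>A skipped letter keeps its fundamental weight fixed and so is no descent; hence the
  inversion set decides which rule was used.\<close>

lemma sortable_cases:
  assumes "sortable (t # d) w" "t \<notin> set d"
  shows "(if \<alpha> t \<in> inversions w then sortable (d @ [t]) (s t \<circ> w) else sortable d w)"
  using assms(1)
proof cases
  case skip
  then show ?thesis
    using fixes_omega_not_descent[OF sortable_weyl[OF skip] sortable_fixes[OF skip assms(2)]] by simp
next
  case (take v)
  have v: "v \<in> W" using take sortable_weyl by blast
  then have "\<alpha> t \<in> inversions w"
    using simple_inversion(1)[of w t] take by (simp add: weyl_comp)
  then show ?thesis using take by simp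
qed

lemma sortable_apply:
  assumes "w \<in> W" "\<alpha> t \<in> inversions w" "sortable (d @ [t]) (s t \<circ> w)"
  shows "sortable (t # d) w"
  using sortable.take[OF assms(3)] simple_inversion(1)[OF assms(1)] assms(2) by simp

text \<open>For the first letter \<open>t\<close> the form of \<open>\<delta>\<close> with \<open>\<alpha>\<^sub>t\<close> is a positive multiple of the coefficient of
  \<open>\<alpha>\<^sub>t\<close> in \<open>\<delta>\<close>, so a closed inversion set that omits \<open>\<alpha>\<^sub>t\<close> has no root involving it, and \<open>t\<close> may be
  discarded.\<close>
theorem sortable_if_euler_closed:
  assumes "w \<in> W" "distinct d" "\<And>i. i \<notin> set d \<Longrightarrow> w (omega i) = omega i"
    and "\<And>\<delta> \<beta>. \<delta> \<in> inversions w \<Longrightarrow> \<beta> \<in> roots \<Longrightarrow> nonneg \<beta> \<Longrightarrow>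
          (\<And>i. i \<notin> set d \<Longrightarrow> cf i \<beta> = 0) \<Longrightarrow> euler d \<delta> \<beta> > 0 \<Longrightarrow> \<beta> \<in> inversions w"
  shows "sortable d w"
  using assms
\<comment> \<open>Taking a letter shortens \<open>w\<close> and preserves the length of the list;
  skipping one does the converse.\<close>
proof (induction "len w + length d" arbitrary: w d rule: less_induct)
  case less
  note w = less.prems(1) and fixes_w = less.prems(3) and closed = less.prems(4)
  show ?case
  proof (cases d)
    case Nil
    then have "w = id" using fixes_w by (intro weyl_eqI[OF w]) auto
    with Nil show ?thesis by (simp add: sortable.base)
  next
    case (Cons t e)
    have te: "t \<notin> set e" "distinct e" using less.prems(2) Cons by auto
    show ?thesis
    proof (cases "\<alpha> t \<in> inversions w")
      case True
      define v where "v = s t \<circ> w"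
      have v: "v \<in> W" "w = s t \<circ> v" "len v < len w"
        using True simple_inversion(1)[OF w] w by (auto simp: v_def)
      have lt: "len v < len (s t \<circ> v)" using v by simp
      have supp_s: "cf i (s t x) = cf i x" if "i \<notin> set d" for i x
        using that Cons by (auto simp: cf_s)
      have "sortable (e @ [t]) v"
      proof (rule less.hyps)
        show "len v + length (e @ [t]) < len w + length d" using v Cons by simp
        show "distinct (e @ [t])" using te by simp
        show "v (omega i) = omega i" if "i \<notin> set (e @ [t])" for i
          using that fixes_w[of i] Cons by (auto simp: v_def sref_omega)
        fix \<delta> \<beta>
        assume \<delta>: "\<delta> \<in> inversions v" and \<beta>: "\<beta> \<in> roots" "nonneg \<beta>"
          and supp: "\<And>i. i \<notin> set (e @ [t]) \<Longrightarrow> cf i \<beta> = 0" and pos: "euler (e @ [t]) \<delta> \<beta> > 0"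
        have s\<delta>: "s t \<delta> \<in> inversions w"
          using inversions_subset[OF v(1) lt \<delta>] v(2) by simp
        have "cf i \<delta> = 0" if "i \<notin> set (t # e)" for i
          using inversion_support[OF w fixes_w s\<delta>] supp_s that Cons by simp
        then have eq: "euler (t # e) (s t \<delta>) (s t \<beta>) = euler (e @ [t]) \<delta> \<beta>"
          using te supp by (intro euler_rotate) auto
        \<comment> \<open>The reflected root would be \<open>- \<alpha> t\<close>, whose form with
          the positive root \<open>s t \<delta>\<close> is nonpositive.\<close>
        have ne: "\<beta> \<noteq> \<alpha> t"
        proof
          assume "\<beta> = \<alpha> t"
          then have "euler (e @ [t]) \<delta> \<beta> = - euler (t # e) (s t \<delta>) (\<alpha> t)"
            using eq by (simp only: s_root euler_minus_right)
          also have "\<dots> \<le> 0"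
            using s\<delta> D_pos[of t] euler_root_first[OF te(1), of "s t \<delta>"]
            by (simp add: inversions_def nonneg_def)
          finally show False using pos by simp
        qed
        have "s t \<beta> \<in> inversions w"
        proof (rule closed[OF s\<delta>])
          show "s t \<beta> \<in> roots" using \<beta>(1) by (simp add: weyl_roots)
          show "nonneg (s t \<beta>)" using s_nonneg[OF \<beta> ne] .
          show "cf i (s t \<beta>) = 0" if "i \<notin> set d" for i
            using supp[of i] supp_s[OF that] that Cons by simp
          show "euler d (s t \<delta>) (s t \<beta>) > 0" using eq pos Cons by simp
        qed
        then show "\<beta> \<in> inversions v"
          using inversions_s_comp[OF w \<beta>(2) ne] by (simp add: v_def)
      qed (rule v(1))
      then show ?thesis using sortable.take[OF _ lt] v(2) Cons by simp
    next
      case False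
      have cf0: "cf t \<delta> = 0" if \<delta>: "\<delta> \<in> inversions w" for \<delta>
      proof (rule ccontr)
        assume "cf t \<delta> \<noteq> 0"
        then have "cf t \<delta> > 0" using \<delta> by (simp add: inversions_def nonneg_def less_le)
        then have "euler d \<delta> (\<alpha> t) > 0"
          using euler_root_first[OF te(1)] D_pos[of t] Cons by simp
        then have "\<alpha> t \<in> inversions w"
          using Cons by (intro closed[OF \<delta>]) (auto simp: nonneg_root cf_root)
        with False show False by simp
      qed
      have ft: "w (omega t) = omega t" by (rule fixes_omega[OF w cf0])
      have "sortable e w"
      proof (rule less.hyps)
        show "len w + length e < len w + length d" using Cons by simp
        show "w (omega i) = omega i" if "i \<notin> set e" for i
          using that ft fixes_w[of i] Cons by (cases "i = t") auto
        fix \<delta> \<beta>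
        assume \<delta>: "\<delta> \<in> inversions w" and \<beta>: "\<beta> \<in> roots" "nonneg \<beta>"
          and supp: "\<And>i. i \<notin> set e \<Longrightarrow> cf i \<beta> = 0" and pos: "euler e \<delta> \<beta> > 0"
        show "\<beta> \<in> inversions w"
        proof (rule closed[OF \<delta> \<beta>])
          show "cf i \<beta> = 0" if "i \<notin> set d" for i using that supp Cons by simp
          show "euler d \<delta> \<beta> > 0" using pos cf0[OF \<delta>] Cons by simp
        qed
      qed (use w te in auto)
      then show ?thesis using Cons by (simp add: sortable.skip)
    qed
  qed
qed

text \<open>Every positive root is an inversion of \<open>w0\<close>, so the closure condition holds
  at once.\<close>

corollary sortable_w0:
  assumes "distinct d" "set d = UNIV"
  shows "sortable d w0"
  using assms longest(1) by (intro sortable_if_euler_closed) (auto simp: inversions_w0)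

text \<open>Induction along the derivation. A skipped letter has coefficient zero in
  \<open>\<delta>\<close>, hence in both summands; a taken letter is reflected away by
  \<open>euler_rotate\<close>. If \<open>\<beta>\<close> is \<open>\<alpha> t\<close> it is an
  inversion outright, and \<open>\<beta>'\<close> cannot be \<open>\<alpha> t\<close> because of the
  strict inequality.\<close>

theorem sortable_aligned:
  assumes "sortable d u" "distinct d" "\<delta> \<in> inversions u"
    and "\<beta> \<in> roots" "nonneg \<beta>" "\<beta>' \<in> roots" "nonneg \<beta>'"
    and "\<delta> = x \<odot> \<beta> + y \<odot> \<beta>'" "x > 0" "y > 0"
    and "euler d \<beta> \<beta>' < euler d \<beta>' \<beta>"
  shows "\<beta> \<in> inversions u"
  using assms
proof (induction arbitrary: \<delta> \<beta> \<beta>' rule: sortable.induct)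
  case base
  then show ?case by simp
next
  case (skip d w t)
  have "w (omega t) = omega t" using skip.prems(1) skip.hyps sortable_fixes by auto
  then have "cf t \<delta> = 0"
    using inversion_support[OF sortable_weyl[OF skip.hyps]] skip.prems by blast
  then have "x * cf t \<beta> + y * cf t \<beta>' = 0" by (simp only: skip.prems(7) cf_linear)
  moreover have "cf t \<beta> \<ge> 0" "cf t \<beta>' \<ge> 0" using skip.prems by (simp_all add: nonneg_def)
  ultimately have "cf t \<beta> = 0" "cf t \<beta>' = 0"
    using skip.prems by (auto simp: add_nonneg_eq_0_iff)
  then have "euler d \<beta> \<beta>' < euler d \<beta>' \<beta>" using skip.prems(10) by simp
  then show ?case using skip.IH[of \<delta> \<beta> \<beta>'] skip.prems by simp
next
  case (take d t w)
  have w: "w \<in> W" using take.hyps(1) by (rule sortable_weyl)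
  have td: "t \<notin> set d" using take.prems(1) by simp
  note pos = take.prems(4,6) and r = take.prems(3,5)
  have \<alpha>in: "\<alpha> t \<in> inversions (s t \<circ> w)"
    using simple_inversion(1)[of "s t \<circ> w" t] take.hyps w by (simp add: weyl_comp)
  have ne': "\<beta>' \<noteq> \<alpha> t"
  proof
    assume "\<beta>' = \<alpha> t"
    then have "euler (t # d) \<beta>' \<beta> \<le> euler (t # d) \<beta> \<beta>'"
      using euler_first_root_le[OF td pos(1)] euler_root_first[OF td, of \<beta>] by simp
    with take.prems(10) show False by simp
  qed
  show ?case
  proof (cases "\<beta> = \<alpha> t")
    case False
    have supp: "cf i \<beta> = 0 \<and> cf i \<beta>' = 0" if "i \<notin> set (t # d)" for i
    proof -
      have "(s t \<circ> w) (omega i) = omega i"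
        using sortable_fixes[OF sortable.take[OF take.hyps]] that by blast
      then have "cf i \<delta> = 0"
        using inversion_support[of "s t \<circ> w"] take.prems(2) w by blast
      then have "x * cf i \<beta> + y * cf i \<beta>' = 0" by (simp only: take.prems(7) cf_linear)
      moreover have "cf i \<beta> \<ge> 0" "cf i \<beta>' \<ge> 0" using pos by (simp_all add: nonneg_def)
      ultimately show ?thesis using take.prems by (auto simp: add_nonneg_eq_0_iff)
    qed
    have nn: "nonneg (s t \<beta>)" "nonneg (s t \<beta>')"
      using s_nonneg r pos False ne' by auto
    have s\<delta>: "s t \<delta> = x \<odot> s t \<beta> + y \<odot> s t \<beta>'"
      by (simp only: take.prems(7) sref_add sref_smul)
    have ne\<delta>: "\<delta> \<noteq> \<alpha> t"
    proof
      assume "\<delta> = \<alpha> t"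
      then have "- \<alpha> t = x \<odot> s t \<beta> + y \<odot> s t \<beta>'" using s\<delta> by simp
      moreover have "nonneg (x \<odot> s t \<beta> + y \<odot> s t \<beta>')"
        using nn take.prems by (intro nonneg_combine) auto
      ultimately show False
        using root_coherent[OF simple_root_in_roots, of t] by (simp add: nonneg_root)
    qed
    have \<delta>: "s t \<delta> \<in> inversions w"
    proof -
      have "nonneg \<delta>" using take.prems(2) by (simp only: inversions_def mem_Collect_eq)
      then show ?thesis using inversions_s_comp[OF w _ ne\<delta>] take.prems(2) by blast
    qed
    have e: "euler (d @ [t]) (s t p) (s t q) = euler (t # d) p q"
      if "\<And>i. i \<notin> set (t # d) \<Longrightarrow> cf i p = 0" "\<And>i. i \<notin> set (t # d) \<Longrightarrow> cf i q = 0" for p q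
      using euler_rotate[OF take.prems(1), of "s t p" "s t q"] that by (simp add: cf_s)
    have "s t \<beta> \<in> inversions w"
    proof (rule take.IH[OF _ \<delta> _ nn(1) _ nn(2) s\<delta>])
      show "euler (d @ [t]) (s t \<beta>) (s t \<beta>') < euler (d @ [t]) (s t \<beta>') (s t \<beta>)"
        using take.prems(10) e supp by simp
    qed (use take.prems r weyl_roots[OF sref_in_weyl] in auto)
    then show ?thesis
      using inversions_s_comp[OF w pos(1) False] by blast
  qed (use \<alpha>in in blast)
qed

section \<open>Singletons\<close>

lemma s_commute: "A i j = 0 \<Longrightarrow> s i \<circ> s j = s j \<circ> s i"
  using A_zero[of i j] by (auto simp: sref_def fun_eq_iff)

lemma s_root_commute: "A i j = 0 \<Longrightarrow> s i (\<alpha> j) = \<alpha> j"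
  by (auto simp: sref_def simple_root_def)

lemma simple_root_neq: "i \<noteq> j \<Longrightarrow> \<alpha> i \<noteq> \<alpha> j"
  by (metis cf_root zero_neq_one)

lemma inversion_commute:
  assumes "w \<in> W" "A i j = 0" "i \<noteq> j"
  shows "\<alpha> j \<in> inversions (s i \<circ> w) \<longleftrightarrow> \<alpha> j \<in> inversions w"
  using inversions_s_comp[OF assms(1) nonneg_root, of j i] s_root_commute[OF assms(2)]
    simple_root_neq[of j i] assms(3) by simp

text \<open>Applying one of two commuting reflections does not affect whether the other is a
  descent, so both orders make the same choices. The letters of \<open>p\<close> are processed
  first.\<close>

lemma sortable_swap_imp:
  assumes "sortable (p @ a # b # q) w" "distinct (p @ a # b # q)" "A a b = 0"
  shows "sortable (p @ b # a # q) w"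
  using assms(1,2)
proof (induction "len w + length p + length q" arbitrary: p q w rule: less_induct)
  case less
  have w: "w \<in> W" using less.prems(1) by (rule sortable_weyl)
  have len: "len (s i \<circ> w) < len w" if "\<alpha> i \<in> inversions w" for i
    using that simple_inversion(1)[OF w] by blast
  show ?case
  proof (cases p)
    case (Cons t p')
    have t: "t \<notin> set (p' @ a # b # q)" using less.prems(2) Cons by auto
    have srt: "sortable (t # p' @ a # b # q) w" using less.prems(1) Cons by simp
    show ?thesis
    proof (cases "\<alpha> t \<in> inversions w")
      case True
      then have "sortable (p' @ a # b # q @ [t]) (s t \<circ> w)"
        using sortable_cases[OF srt t] by simp
      then have "sortable (p' @ b # a # q @ [t]) (s t \<circ> w)"
        using less.prems(2) Cons len[OF True] by (intro less.hyps) auto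
      then show ?thesis using sortable_apply[OF w True] Cons by simp
    next
      case False
      then have "sortable (p' @ a # b # q) w"
        using sortable_cases[OF srt t] by simp
      then have "sortable (p' @ b # a # q) w"
        using less.prems(2) Cons by (intro less.hyps) auto
      then show ?thesis using sortable.skip Cons by simp
    qed
  next
    case Nil
    have ab: "a \<noteq> b" "a \<notin> set (b # q)" "b \<notin> set q" "b \<notin> set (q @ [a])"
      using less.prems(2) Nil by auto
    have ba: "A b a = 0" using A_zero assms(3) by blast
    have srt: "sortable (a # b # q) w" using less.prems(1) Nil by simp
    show ?thesis
    proof (cases "\<alpha> a \<in> inversions w")
      case a: True
      define w1 where "w1 = s a \<circ> w"
      have w1: "w1 \<in> W" "sortable (b # q @ [a]) w1"
        using sortable_cases[OF srt ab(2)] a w by (auto simp: w1_def)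
      have b: "\<alpha> b \<in> inversions w1 \<longleftrightarrow> \<alpha> b \<in> inversions w"
        unfolding w1_def using w assms(3) ab(1) by (rule inversion_commute)
      show ?thesis
      proof (cases "\<alpha> b \<in> inversions w")
        case True
        have "sortable (q @ [a] @ [b]) (s b \<circ> w1)"
          using sortable_cases[OF w1(2) ab(4)] True b by simp
        moreover have "len (s b \<circ> w1) < len w"
          using len[OF a] simple_inversion(1)[OF w1(1), of b] True b by (simp add: w1_def)
        \<comment> \<open>With both letters at the end the lists keep their total length; the
          induction applies because the element has become shorter.\<close>
        ultimately have "sortable (q @ b # a # []) (s b \<circ> w1)"
          using ab less.prems(2) Nil by (intro less.hyps) auto
        moreover have "s b \<circ> w1 = s a \<circ> (s b \<circ> w)"
          using s_commute[OF assms(3)] by (simp add: w1_def comp_assoc[symmetric])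
        ultimately have "sortable ((q @ [b]) @ [a]) (s a \<circ> (s b \<circ> w))" by simp
        moreover have "\<alpha> a \<in> inversions (s b \<circ> w)"
          using inversion_commute[OF w ba] ab(1) a by blast
        ultimately have "sortable ((a # q) @ [b]) (s b \<circ> w)"
          using sortable_apply w by (simp add: weyl_comp)
        then show ?thesis using sortable_apply[OF w True] Nil by simp
      next
        case False
        then have "sortable (q @ [a]) (s a \<circ> w)"
          using sortable_cases[OF w1(2) ab(4)] b by (simp add: w1_def)
        then show ?thesis using sortable.skip[OF sortable_apply[OF w a]] Nil by simp
      qed
    next
      case False
      then have bq: "sortable (b # q) w" using sortable_cases[OF srt ab(2)] by simp
      show ?thesis
      proof (cases "\<alpha> b \<in> inversions w")
        case True
        then have "sortable (q @ [b]) (s b \<circ> w)" using sortable_cases[OF bq ab(3)] by simp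
        then have "sortable ((a # q) @ [b]) (s b \<circ> w)" using sortable.skip by simp
        then show ?thesis using sortable_apply[OF w True] Nil by simp
      next
        case False
        then have "sortable q w" using sortable_cases[OF bq ab(3)] by simp
        then show ?thesis using sortable.skip Nil by simp
      qed
    qed
  qed
qed

lemma sortable_swap:
  assumes "distinct (p @ a # b # q)" "A a b = 0"
  shows "sortable (p @ a # b # q) w \<longleftrightarrow> sortable (p @ b # a # q) w"
  using sortable_swap_imp[of p a b q w] sortable_swap_imp[of p b a q w] assms A_zero[of a b] by auto

lemma sortable_move:
  assumes "distinct (p @ d @ r # q)" "\<And>x. x \<in> set d \<Longrightarrow> A x r = 0"
  shows "sortable (p @ d @ r # q) w \<longleftrightarrow> sortable (p @ r # d @ q) w"
  using assms
proof (induction d arbitrary: p)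
  case (Cons x d)
  have "sortable (p @ (x # d) @ r # q) w \<longleftrightarrow> sortable ((p @ [x]) @ r # d @ q) w"
    using Cons.IH[of "p @ [x]"] Cons.prems by simp
  also have "\<dots> \<longleftrightarrow> sortable (p @ r # (x # d) @ q) w"
    using sortable_swap[of p x r "d @ q" w] Cons.prems by auto
  finally show ?case .
qed simp

lemma ev_move:
  assumes "\<And>x. x \<in> set d \<Longrightarrow> A x r = 0"
  shows "ev (d @ r # q) = ev (r # d @ q)"
  using assms
proof (induction d)
  case (Cons x d)
  have IH: "ev (d @ r # q) = ev (r # d @ q)" using Cons by (meson list.set_intros(2))
  have "ev ((x # d) @ r # q) = s x \<circ> ev (r # d @ q)"
    by (simp only: append_Cons word_eval_Cons[of _ x] IH)
  also have "\<dots> = (s x \<circ> s r) \<circ> ev (d @ q)" by (simp add: comp_assoc)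
  also have "\<dots> = (s r \<circ> s x) \<circ> ev (d @ q)" using s_commute[of x r] Cons.prems by simp
  finally show ?case by (simp add: comp_assoc)
qed simp

text \<open>List version of \<open>c_singleton\<close>; \<open>c_singleton_iff\<close> identifies
  the two.\<close>

definition singleton :: "'i list \<Rightarrow> (('i \<Rightarrow> real) \<Rightarrow> ('i \<Rightarrow> real)) \<Rightarrow> bool" where
  "singleton d w \<longleftrightarrow> sortable d w \<and> sortable (rev d) (w \<circ> w0)"

lemma singleton_weyl: "singleton d w \<Longrightarrow> w \<in> W"
  by (auto simp: singleton_def sortable_weyl)

lemma singleton_move:
  assumes "distinct (d @ r # q)" "\<And>x. x \<in> set d \<Longrightarrow> A x r = 0"
  shows "singleton (d @ r # q) w \<longleftrightarrow> singleton (r # d @ q) w"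
proof -
  have "sortable (rev q @ rev d @ r # []) v \<longleftrightarrow> sortable (rev q @ r # rev d @ []) v" for v
    using assms by (intro sortable_move) auto
  then show ?thesis
    using sortable_move[of "[]" d r q w] assms by (simp add: singleton_def)
qed

lemma w0_inversion:
  "w \<in> W \<Longrightarrow> \<alpha> r \<in> inversions (w \<circ> w0) \<longleftrightarrow> \<alpha> r \<notin> inversions w"
  by (simp add: inversions_comp_w0 nonneg_root)

text \<open>Passing from \<open>s r \<circ> w\<close> to \<open>w\<close> removes a first letter on
  the sortable side and adds one on the antisortable side, where the list is reversed.\<close>

lemma singleton_rotate:
  assumes "w \<in> W" "\<alpha> r \<notin> inversions w" "distinct (r # d)"
  shows "singleton (r # d) (s r \<circ> w) \<longleftrightarrow> singleton (d @ [r]) w"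
proof -
  have up: "len w < len (s r \<circ> w)"
    using simple_inversion(2)[OF assms(1)] assms(2) by blast
  have sw: "s r \<circ> w \<in> W" using assms(1) by blast
  have r: "\<alpha> r \<in> inversions (s r \<circ> w)"
    using simple_inversion(1)[OF sw] up by simp
  have "sortable (r # d) (s r \<circ> w) \<longleftrightarrow> sortable (d @ [r]) w"
    using sortable_cases[of r d "s r \<circ> w"] sortable_apply[OF sw r] r assms(3) by auto
  moreover have ww: "w \<circ> w0 \<in> W" using assms(1) longest(1) by blast
  have rw: "\<alpha> r \<in> inversions (w \<circ> w0)"
    using w0_inversion[OF assms(1)] assms(2) by blast
  have "sortable (r # rev d) (w \<circ> w0) \<longleftrightarrow> sortable (rev d @ [r]) (s r \<circ> (w \<circ> w0))"
    using sortable_cases[of r "rev d" "w \<circ> w0"] sortable_apply[OF ww rw] rw assms(3) by auto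
  ultimately show ?thesis by (auto simp: singleton_def comp_assoc)
qed

lemma euler_ordered:
  assumes "distinct (p @ r # q)" "x \<in> set q"
  shows "euler (p @ r # q) (\<alpha> r) (\<alpha> x) = K r x" "euler (p @ r # q) (\<alpha> x) (\<alpha> r) = 0"
proof -
  have *: "euler (r # q) (\<alpha> r) (\<alpha> x) = K r x \<and> euler (r # q) (\<alpha> x) (\<alpha> r) = 0"
  proof
    have rx: "r \<noteq> x" "r \<notin> set q" "distinct q" using assms by auto
    have "(\<Sum>j\<leftarrow>q. K r j * cf j (\<alpha> x)) = (\<Sum>j\<in>set q. if j = x then K r x else 0)"
      unfolding sum_list_distinct_conv_sum_set[OF rx(3)] by (intro sum.cong) (auto simp: cf_root)
    also have "\<dots> = K r x" using assms(2) by simp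
    finally have "(\<Sum>j\<leftarrow>q. K r j * cf j (\<alpha> x)) = K r x" .
    moreover have "euler q (\<alpha> r) (\<alpha> x) = 0"
      using rx by (intro euler_zero_left) (auto simp: cf_root)
    ultimately show "euler (r # q) (\<alpha> r) (\<alpha> x) = K r x"
      using rx by (simp add: cf_root)
    show "euler (r # q) (\<alpha> x) (\<alpha> r) = 0"
      using rx by (subst euler_root_first) (auto simp: cf_root)
  qed
  have "euler (p @ r # q) (\<alpha> r) (\<alpha> x) = euler (r # q) (\<alpha> r) (\<alpha> x) \<and>
     euler (p @ r # q) (\<alpha> x) (\<alpha> r) = euler (r # q) (\<alpha> x) (\<alpha> r)"
    using assms by (induction p) (auto simp: cf_root)
  with * show "euler (p @ r # q) (\<alpha> r) (\<alpha> x) = K r x" "euler (p @ r # q) (\<alpha> x) (\<alpha> r) = 0"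
    by auto
qed

text \<open>\<open>r\<close> is the first letter taken; the letters of \<open>d1\<close> are
  skipped, so their fundamental weights are fixed.\<close>

lemma sortable_first_letter:
  assumes "sortable d w" "w \<noteq> id" "distinct d"
  shows "\<exists>d1 r d2. d = d1 @ r # d2 \<and> \<alpha> r \<in> inversions w \<and> sortable (d2 @ [r]) (s r \<circ> w) \<and>
    (\<forall>i\<in>set d1. w (omega i) = omega i)"
  using assms
proof (induction d)
  case Nil
  then show ?case by (auto elim: sortable.cases)
next
  case (Cons t e)
  have t: "t \<notin> set e" using Cons.prems(3) by simp
  show ?case
  proof (cases "\<alpha> t \<in> inversions w")
    case True
    then have "sortable (e @ [t]) (s t \<circ> w)" using sortable_cases[OF Cons.prems(1) t] by simp
    moreover have "t # e = [] @ t # e" by simp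
    ultimately show ?thesis using True by (metis empty_iff list.set(1))
  next
    case False
    then have se: "sortable e w" using sortable_cases[OF Cons.prems(1) t] by simp
    then obtain d1 r d2 where d: "e = d1 @ r # d2" "\<alpha> r \<in> inversions w"
      "sortable (d2 @ [r]) (s r \<circ> w)" "\<forall>i\<in>set d1. w (omega i) = omega i"
    proof -
      have "distinct e" using Cons.prems(3) by simp
      from Cons.IH[OF se Cons.prems(2) this] show ?thesis using that by (elim exE conjE)
    qed
    moreover have "w (omega t) = omega t" by (rule sortable_fixes[OF se t])
    ultimately have "t # e = (t # d1) @ r # d2 \<and> \<alpha> r \<in> inversions w \<and> sortable (d2 @ [r]) (s r \<circ> w) \<and>
        (\<forall>i\<in>set (t # d1). w (omega i) = omega i)"
      by simp
    then show ?thesis by (intro exI)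
  qed
qed

text \<open>Otherwise \<open>s\<^sub>x \<alpha>\<^sub>r\<close> is an inversion of \<open>w w\<^sub>0\<close>, being outside the parabolic of \<open>w\<close>, and alignment
  for the reversed order puts \<open>\<alpha>\<^sub>r\<close> among the inversions of \<open>w w\<^sub>0\<close>, against the choice of \<open>r\<close>.\<close>
lemma singleton_first_letter_commutes:
  assumes "singleton (d1 @ r # d2) w" "distinct (d1 @ r # d2)" "\<alpha> r \<in> inversions w"
    and "x \<in> set d1" "w (omega x) = omega x"
  shows "A x r = 0"
proof (rule ccontr)
  assume nz: "A x r \<noteq> 0"
  have w: "w \<in> W" using assms(1) by (rule singleton_weyl)
  have xr: "x \<noteq> r" using assms(2,4) by auto
  have neg: "A x r < 0" using A_off[OF xr] nz by simp
  define y where "y = - real_of_int (A x r)"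
  have y: "y > 0" using neg by (simp add: y_def)
  have \<delta>: "s x (\<alpha> r) = 1 \<odot> \<alpha> r + y \<odot> \<alpha> x"
    by (auto simp: sref_def simple_root_def y_def)
  have "cf x (s x (\<alpha> r)) > 0" using y xr by (simp add: \<delta> cf_linear cf_root)
  then have "s x (\<alpha> r) \<notin> inversions w"
    using inversion_support[OF w assms(5)] by fastforce
  moreover have "s x (\<alpha> r) \<in> roots" by (simp add: weyl_roots)
  moreover have "nonneg (s x (\<alpha> r))"
    using simple_root_neq[of r x] xr by (intro s_nonneg) (auto simp: nonneg_root)
  ultimately have \<delta>in: "s x (\<alpha> r) \<in> inversions (w \<circ> w0)"
    by (simp add: inversions_comp_w0[OF w])
  have d: "distinct (rev d2 @ r # rev d1)" "x \<in> set (rev d1)" using assms(2,4) by auto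
  have "K r x < 0"
    using neg D_pos[of x] by (simp add: ip_root_root mult_neg_pos)
  have "\<alpha> r \<in> inversions (w \<circ> w0)"
  proof (rule sortable_aligned[OF _ d(1) \<delta>in _ _ _ _ \<delta>])
    show "sortable (rev d2 @ r # rev d1) (w \<circ> w0)" using assms(1) by (simp add: singleton_def)
  qed (use y \<open>K r x < 0\<close> euler_ordered[OF d] in \<open>simp_all add: nonneg_root\<close>)
  then show False using w0_inversion[OF w] assms(3) by simp
qed

text \<open>With the first letter \<open>r\<close> removed, the induction hypothesis concerns the
  conjugate \<open>c'\<close> of \<open>c\<close> by \<open>s r\<close>. The exponent grows by one
  exactly if \<open>j = r\<close>, since \<open>c\<close> and \<open>s r\<close> agree on
  \<open>omega r\<close>. The differences later bound the exponent, and the smaller singletons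
  realize the earlier powers.\<close>

theorem singleton_chain:
  assumes "singleton d w" "distinct d" "set d = UNIV"
  shows "\<exists>m. w (omega j) = (ev d ^^ m) (omega j) \<and>
    (\<forall>k<m. (ev d ^^ k) (omega j) - (ev d ^^ Suc k) (omega j) \<in> inversions w) \<and>
    (\<forall>k\<le>m. \<exists>w'. singleton d w' \<and> inversions w' \<subseteq> inversions w \<and> w' (omega j) = (ev d ^^ k) (omega j))"
  using assms
proof (induction "len w" arbitrary: w d rule: less_induct)
  case less
  \<comment> \<open>The identity is antisortable because \<open>w0\<close> is sortable for the
    reversed list.\<close>
  have id: "singleton d id"
    using sortable_w0[of "rev d"] less.prems by (simp add: singleton_def)
  show ?case
  proof (cases "w = id")
    case True
    then show ?thesis using id by (intro exI[of _ 0]) auto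
  next
    case False
    have w: "w \<in> W" using less.prems(1) by (rule singleton_weyl)
    obtain d1 r d2 where d: "d = d1 @ r # d2" and r: "\<alpha> r \<in> inversions w"
      and fix1: "\<forall>i\<in>set d1. w (omega i) = omega i"
      using sortable_first_letter[OF _ False less.prems(2)] less.prems(1) by (auto simp: singleton_def)
    have comm: "A x r = 0" if "x \<in> set d1" for x
      using singleton_first_letter_commutes[of d1 r d2 w x] less.prems d r fix1 that by simp
    \<comment> \<open>Since \<open>r\<close> commutes with the letters of \<open>d1\<close>, it may
      be moved to the front, leaving \<open>e\<close>.\<close>
    define e where "e = d1 @ d2"
    have dist: "distinct (r # e)" "set (e @ [r]) = UNIV"
      using less.prems(2,3) by (auto simp: d e_def)
    have sing: "singleton d u \<longleftrightarrow> singleton (r # e) u" for u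
      using singleton_move[of d1 r d2, OF _ comm] less.prems(2) by (simp add: d e_def)
    define c where "c = ev d"
    define c' where "c' = ev (e @ [r])"
    have c: "c = s r \<circ> ev e" unfolding c_def d e_def using ev_move[OF comm] by simp
    have c': "c' = ev e \<circ> s r" by (simp add: c'_def)
    have pow: "(c ^^ k) (s r x) = s r ((c' ^^ k) x)" for k x
      by (induction k) (simp_all add: c c')
    have cr: "c (omega r) = s r (omega r)"
    proof -
      have "ev us (omega r) = omega r" if "r \<notin> set us" for us
        using that by (induction us) (auto simp: sref_omega)
      then show ?thesis using dist c by simp
    qed
    define v where "v = s r \<circ> w"
    have v: "v \<in> W" "w = s r \<circ> v" "len v < len w"
      using w r simple_inversion(1)[OF w, of r] by (auto simp: v_def)
    have vr: "\<alpha> r \<notin> inversions v" using simple_inversion(2)[OF v(1), of r] v by simp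
    have "singleton (e @ [r]) v"
      using singleton_rotate[OF v(1) vr dist(1)] sing less.prems(1) v(2) by simp
    from less.hyps[OF v(3) this] dist obtain m where
      m: "v (omega j) = (c' ^^ m) (omega j)"
      and roots: "\<And>k. k < m \<Longrightarrow> (c' ^^ k) (omega j) - (c' ^^ Suc k) (omega j) \<in> inversions v"
      and pre: "\<And>k. k \<le> m \<Longrightarrow> \<exists>w'. singleton (e @ [r]) w' \<and> inversions w' \<subseteq> inversions v \<and> w' (omega j) = (c' ^^ k) (omega j)"
      unfolding c'_def by auto
    have sm: "s r x - s r y = s r (x - y)" for x y
      by (rule weyl_diff[OF sref_in_weyl, symmetric])
    have roots': "(c ^^ k) (s r (omega j)) - (c ^^ Suc k) (s r (omega j)) \<in> inversions w" if "k < m" for k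
      using inversions_subset[OF v(1) _ roots[OF that], of r] v unfolding pow sm by simp
    have pre': "\<exists>w'. singleton d w' \<and> inversions w' \<subseteq> inversions w \<and> w' (omega j) = (c ^^ k) (s r (omega j))"
      if km: "k \<le> m" for k
    proof -
      obtain w' where w': "singleton (e @ [r]) w'" "inversions w' \<subseteq> inversions v" "w' (omega j) = (c' ^^ k) (omega j)"
        using pre[OF km] by blast
      have W': "w' \<in> W" using w'(1) by (rule singleton_weyl)
      \<comment> \<open>The claim includes containment of inversion sets for this purpose:
        \<open>r\<close> must still be an ascent of \<open>w'\<close>.\<close>
      have "\<alpha> r \<notin> inversions w'" using w'(2) vr by blast
      then have "singleton d (s r \<circ> w')"
        using singleton_rotate[OF W' _ dist(1)] w'(1) sing by simp
      moreover have "inversions (s r \<circ> w') \<subseteq> inversions w"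
      proof
        fix \<beta> assume \<beta>: "\<beta> \<in> inversions (s r \<circ> w')"
        then have nn: "nonneg \<beta>" by (simp add: inversions_def)
        show "\<beta> \<in> inversions w"
          using r inversions_s_comp[OF W' nn] inversions_s_comp[OF v(1) nn] \<beta> w'(2) v(2)
          by (cases "\<beta> = \<alpha> r") auto
      qed
      ultimately show ?thesis using w'(3) pow by (intro exI[of _ "s r \<circ> w'"]) simp
    qed
    have wj: "w (omega j) = (c ^^ m) (s r (omega j))" using m v(2) pow by simp
    show ?thesis
    proof (cases "j = r")
      case False
      then have "s r (omega j) = omega j" by (simp add: sref_omega)
      then have fix_j: "s r (omega j) = omega j" .
      show ?thesis
        unfolding c_def[symmetric]
        using wj[unfolded fix_j] roots'[unfolded fix_j] pre'[unfolded fix_j] by blast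
    next
      case True
      have shift: "(c ^^ k) (s r (omega j)) = (c ^^ Suc k) (omega j)" for k
        using cr True by (simp add: funpow_swap1)
      have 1: "(c ^^ k) (omega j) - (c ^^ Suc k) (omega j) \<in> inversions w" if "k < Suc m" for k
      proof (cases k)
        case 0
        have "omega r - s r (omega r) = \<alpha> r" by (simp add: sref_omega)
        then show ?thesis using 0 cr r True by simp
      next
        case (Suc k')
        then show ?thesis using roots'[of k', unfolded shift] that by (simp only: Suc_less_eq)
      qed
      have 2: "\<exists>w'. singleton d w' \<and> inversions w' \<subseteq> inversions w \<and> w' (omega j) = (c ^^ k) (omega j)"
        if "k \<le> Suc m" for k
      proof (cases k)
        case 0
        then show ?thesis using id by (intro exI[of _ id]) simp
      next
        case (Suc k')
        then show ?thesis using pre'[of k', unfolded shift] that by (simp only: Suc_le_mono)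
      qed
      show ?thesis
        unfolding c_def[symmetric] using wj[unfolded shift] 1 2 by blast
    qed
  qed
qed

end

section \<open>Sorting words\<close>

lemma coxeter_word_props:
  assumes "coxeter_word cw"
  shows "distinct cw" "set cw = UNIV" "length cw > 0"
  using assms by (auto simp: coxeter_word_def)

lemma nth_rotate_cinf: "j < length cw \<Longrightarrow> rotate p cw ! j = cinf cw (p + j)"
  by (simp add: nth_rotate cinf_def)

lemma rotate_Cons:
  assumes "cw \<noteq> []"
  obtains e where "rotate p cw = cinf cw p # e" "rotate (Suc p) cw = e @ [cinf cw p]"
proof -
  obtain t e where te: "rotate p cw = t # e"
    using assms by (metis neq_Nil_conv rotate_is_Nil_conv)
  moreover have "t = cinf cw p"
    using nth_rotate_cinf[of 0 cw p] te assms by simp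
  ultimately show ?thesis using that by simp
qed

lemma cinf_add_length [simp]: "cinf cw (p + length cw) = cinf cw p"
  by (simp add: cinf_def)

lemma cinf_eqD:
  assumes "distinct cw" "cw \<noteq> []" "cinf cw q = cinf cw p" "p \<le> q"
  obtains j where "q = p + j * length cw"
proof -
  have "q mod length cw = p mod length cw"
    using assms by (simp add: cinf_def nth_eq_iff_index_eq)
  then have "length cw dvd q - p" using assms(4) by (simp add: mod_eq_dvd_iff_nat)
  then obtain j where "q - p = length cw * j" by (rule dvdE)
  then show ?thesis using that[of j] assms(4) by (simp add: mult.commute)
qed

context cartan_weyl
begin

text \<open>When the infinite word is read from position \<open>p\<close> on, with \<open>S\<close> the set of letters not yet discarded,
  the list of available letters is \<^term>\<open>filter (\<lambda>i. i \<in> S) (rotate p cw)\<close>.\<close>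
lemma sortable_if_nested:
  assumes cw: "distinct cw" "cw \<noteq> []"
    and "sorted_wrt (<) ps" "\<And>q. q \<in> set ps \<Longrightarrow> p \<le> q \<and> q < p + k \<and> cinf cw q \<in> S"
    and "\<And>q. p \<le> q \<Longrightarrow> q + length cw \<in> set ps \<Longrightarrow> q \<in> set ps"
    and "len (ev (map (cinf cw) ps)) = length ps"
  shows "sortable (filter (\<lambda>i. i \<in> S) (rotate p cw)) (ev (map (cinf cw) ps))"
  using assms(3-)
\<comment> \<open>\<open>k\<close> bounds the window of positions still to be read, giving an
  induction although the word is infinite.\<close>
proof (induction k arbitrary: p S ps)
  case 0
  then have "ps = []" by (metis add.right_neutral linorder_not_less list.set_intros(1) neq_Nil_conv)
  then have "ev (map (cinf cw) ps) = id" by simp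
  then show ?case by (simp only: sortable_id)
next
  case (Suc k)
  obtain e where e: "rotate p cw = cinf cw p # e" "rotate (Suc p) cw = e @ [cinf cw p]"
    using rotate_Cons[OF cw(2)] .
  have te: "cinf cw p \<notin> set e"
    using cw(1) distinct_rotate[of p cw] e(1) by simp
  note nested = Suc.prems(3)
  show ?case
  proof (cases "p \<in> set ps")
    case True
    obtain x qs where x: "ps = x # qs" using True by (cases ps) auto
    have "x = p"
    proof (rule ccontr)
      assume "x \<noteq> p"
      then have "x < p" using Suc.prems(1) True x by auto
      with Suc.prems(2)[of x] x show False by simp
    qed
    with x have qs: "ps = p # qs" by simp
    have "len (ev ps') \<le> length ps'" for ps' by (rule wlen_le)
    moreover have "len (ev (map (cinf cw) ps)) \<le> Suc (len (ev (map (cinf cw) qs)))"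
      using wlen_comp_le[OF sref_in_weyl weylI, of A "cinf cw p" "map (cinf cw) qs"] wlen_le[of A "[cinf cw p]"]
      by (simp add: qs)
    ultimately have len_qs: "len (ev (map (cinf cw) qs)) = length qs"
      using Suc.prems(4) qs by (metis Suc_le_mono antisym length_Cons length_map)
    have "sortable (filter (\<lambda>i. i \<in> S) (rotate (Suc p) cw)) (ev (map (cinf cw) qs))"
    proof (rule Suc.IH)
      show "sorted_wrt (<) qs" using Suc.prems(1) qs by simp
      show "Suc p \<le> q \<and> q < Suc p + k \<and> cinf cw q \<in> S" if "q \<in> set qs" for q
        using Suc.prems(1) Suc.prems(2)[of q] that qs by auto
      show "q \<in> set qs" if "Suc p \<le> q" "q + length cw \<in> set qs" for q
        using nested[of q] that qs by auto
    qed (rule len_qs)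
    moreover have "cinf cw p \<in> S" using Suc.prems(2)[OF True] by simp
    ultimately have "sortable (filter (\<lambda>i. i \<in> S) e @ [cinf cw p]) (ev (map (cinf cw) qs))"
      by (simp only: e filter_append filter.simps if_True)
    moreover have ev_ps: "ev (map (cinf cw) ps) = s (cinf cw p) \<circ> ev (map (cinf cw) qs)"
      by (simp add: qs)
    moreover have "len (ev (map (cinf cw) qs)) < len (s (cinf cw p) \<circ> ev (map (cinf cw) qs))"
    proof -
      have "len (ev (map (cinf cw) ps)) = length ps" by (rule Suc.prems(4))
      moreover have "length ps = Suc (length qs)" by (simp add: qs)
      ultimately have "len (ev (map (cinf cw) qs)) < len (ev (map (cinf cw) ps))"
        using len_qs by linarith
      then show ?thesis unfolding ev_ps .
    qed
    ultimately have "sortable (cinf cw p # filter (\<lambda>i. i \<in> S) e) (ev (map (cinf cw) ps))"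
      using sortable.take by metis
    then show ?thesis using \<open>cinf cw p \<in> S\<close> by (simp only: e filter.simps if_True)
  next
    case False
    let ?S = "S - {cinf cw p}"
    have gap: "p + j * length cw \<notin> set ps" for j
    proof (induction j)
      case (Suc j)
      then show ?case using nested[of "p + j * length cw"] by (auto simp: add_ac)
    qed (simp add: False)
    have letters: "cinf cw q \<noteq> cinf cw p" if "q \<in> set ps" for q
    proof
      assume eq: "cinf cw q = cinf cw p"
      have "p \<le> q" using Suc.prems(2)[OF that] by simp
      from cinf_eqD[OF cw eq this] gap that show False by metis
    qed
    have "sortable (filter (\<lambda>i. i \<in> ?S) (rotate (Suc p) cw)) (ev (map (cinf cw) ps))"
    proof (rule Suc.IH)
      show "Suc p \<le> q \<and> q < Suc p + k \<and> cinf cw q \<in> ?S" if "q \<in> set ps" for q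
      proof -
        have "q \<noteq> p" using False that by blast
        then show ?thesis using Suc.prems(2)[OF that] letters[OF that] by auto
      qed
      show "q \<in> set ps" if "Suc p \<le> q" "q + length cw \<in> set ps" for q
        using nested that by simp
    qed (use Suc.prems in auto)
    moreover have "filter (\<lambda>i. i \<in> ?S) e = filter (\<lambda>i. i \<in> S) e"
      using te by (intro filter_cong) auto
    ultimately have "sortable (filter (\<lambda>i. i \<in> S) e) (ev (map (cinf cw) ps))"
      using e by simp
    then show ?thesis using e sortable.skip by simp
  qed
qed

text \<open>The positions are chosen greedily. An earlier start is impossible because each skipped
  or discarded letter has its fundamental weight fixed by \<open>w\<close> and so is no left
  descent.\<close>

lemma nested_if_sortable:
  assumes cw: "distinct cw"
    and "sortable (filter (\<lambda>i. i \<in> S) (rotate p cw)) w"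
  shows "\<exists>ps. sorted_wrt (<) ps \<and> (\<forall>q\<in>set ps. p \<le> q \<and> cinf cw q \<in> S) \<and>
     length ps = len w \<and> ev (map (cinf cw) ps) = w \<and>
     (\<forall>q\<ge>p. q + length cw \<in> set ps \<longrightarrow> q \<in> set ps) \<and>
     (\<forall>qs. sorted_wrt (<) qs \<and> (\<forall>q\<in>set qs. p \<le> q) \<and> length qs = len w \<and> ev (map (cinf cw) qs) = w
        \<longrightarrow> qs = ps \<or> (ps, qs) \<in> lexord {(a, b). a < b})"
  using assms(2)
proof (induction "len w" arbitrary: p S w rule: less_induct)
  case less
  define st where "st = filter (\<lambda>i. i \<in> S) (rotate p cw)"
  have st: "sortable st w" "distinct st" using less.prems cw by (auto simp: st_def)
  have w: "w \<in> W" using st(1) by (rule sortable_weyl)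
  show ?case
  proof (cases "w = id")
    case True
    then show ?thesis by (intro exI[of _ "[]"]) auto
  next
    case False
    obtain d1 r d2 where d: "st = d1 @ r # d2" and r: "\<alpha> r \<in> inversions w"
      and srt: "sortable (d2 @ [r]) (s r \<circ> w)" and fix1: "\<forall>i\<in>set d1. w (omega i) = omega i"
      using sortable_first_letter[OF st(1) False st(2)] by blast
    have rS: "r \<in> S" "r \<in> set (rotate p cw)"
    proof -
      have "r \<in> set st" by (simp add: d)
      then show "r \<in> S" "r \<in> set (rotate p cw)" by (simp_all add: st_def)
    qed
    then obtain c1 c2 where c: "rotate p cw = c1 @ r # c2" by (metis split_list)
    have dc: "distinct (c1 @ r # c2)" using cw c by (metis distinct_rotate)
    have f: "d1 = filter (\<lambda>i. i \<in> S) c1" "d2 = filter (\<lambda>i. i \<in> S) c2"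
    proof -
      have "d1 @ r # d2 = filter (\<lambda>i. i \<in> S) c1 @ r # filter (\<lambda>i. i \<in> S) c2"
        using d c rS unfolding st_def by simp
      moreover have "r \<notin> set d1" "r \<notin> set d2"
        using dc st(2) d by auto
      ultimately show "d1 = filter (\<lambda>i. i \<in> S) c1" "d2 = filter (\<lambda>i. i \<in> S) c2"
        by (simp_all add: append_Cons_eq_iff)
    qed
    define p' where "p' = p + length c1"
    have n: "length cw = length c1 + Suc (length c2)" using c by (metis length_append length_Cons length_rotate)
    have p': "p' < p + length cw" by (simp add: p'_def n)
    have c1: "cinf cw q \<in> set c1" if "p \<le> q" "q < p'" for q
    proof -
      have "cinf cw q = rotate p cw ! (q - p)"
        using nth_rotate_cinf[of "q - p" cw p] that n by (simp add: p'_def)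
      also have "\<dots> = c1 ! (q - p)"
      proof -
        have "q - p < length c1" using that unfolding p'_def by linarith
        then show ?thesis by (simp add: c nth_append)
      qed
      finally show ?thesis using that by (simp add: p'_def)
    qed
    have cp': "cinf cw p' = r"
      using nth_rotate_cinf[of "length c1" cw p] n by (simp add: c p'_def)
    have rot: "rotate (Suc p') cw = c2 @ c1 @ [r]"
    proof -
      have "rotate (Suc p') cw = rotate (length (c1 @ [r])) (rotate p cw)"
        by (simp add: rotate_rotate p'_def add_ac)
      also have "\<dots> = c2 @ c1 @ [r]"
        using rotate_append[of "c1 @ [r]" c2] c by simp
      finally show ?thesis .
    qed
    \<comment> \<open>The letters passed over before \<open>r\<close> are discarded;
      \<open>r\<close> stays available at the end of the next list.\<close>
    define T where "T = insert r (set d2)"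
    have "filter (\<lambda>i. i \<in> T) c2 = d2" "filter (\<lambda>i. i \<in> T) c1 = []"
      using dc unfolding f(2) T_def by (auto intro!: filter_cong simp: filter_empty_conv)
    then have rotT: "filter (\<lambda>i. i \<in> T) (rotate (Suc p') cw) = d2 @ [r]"
      using rot by (simp add: T_def)
    define v where "v = s r \<circ> w"
    have v: "v \<in> W" "w = s r \<circ> v" "len v < len w"
      using w r simple_inversion(1)[OF w, of r] by (auto simp: v_def)
    have srt': "sortable (filter (\<lambda>i. i \<in> T) (rotate (Suc p') cw)) v"
      using srt unfolding rotT v_def .
    obtain ps where ps: "sorted_wrt (<) ps" "\<forall>q\<in>set ps. Suc p' \<le> q \<and> cinf cw q \<in> T"
      "length ps = len v" "ev (map (cinf cw) ps) = v"
      and nested: "\<forall>q\<ge>Suc p'. q + length cw \<in> set ps \<longrightarrow> q \<in> set ps"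
      and first: "\<forall>qs. sorted_wrt (<) qs \<and> (\<forall>q\<in>set qs. Suc p' \<le> q) \<and> length qs = len v \<and>
        ev (map (cinf cw) qs) = v \<longrightarrow> qs = ps \<or> (ps, qs) \<in> lexord {(a, b). a < b}"
      using less.hyps[OF v(3) srt'] by (elim exE conjE)
    have len_w: "len w = Suc (len v)"
      using len_s_comp_Suc[OF v(1), of r] v by simp
    have TS: "T \<subseteq> S" using rS by (auto simp: T_def f)
    show ?thesis
    proof (intro exI[of _ "p' # ps"] conjI allI impI ballI)
      show "sorted_wrt (<) (p' # ps)" using ps(1,2) by fastforce
      show "p \<le> q" "cinf cw q \<in> S" if "q \<in> set (p' # ps)" for q
        using that ps(2) TS rS cp' by (auto simp: p'_def)
      show "length (p' # ps) = len w" using ps(3) len_w by simp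
      show "ev (map (cinf cw) (p' # ps)) = w" using ps(4) v(2) cp' by simp
      show "q \<in> set (p' # ps)" if "p \<le> q" "q + length cw \<in> set (p' # ps)" for q
      proof -
        \<comment> \<open>\<open>p'\<close> lies less than one period after \<open>p\<close>, so
          \<open>q + length cw\<close> cannot equal it.\<close>
        have qin: "q + length cw \<in> set ps" using that p' by auto
        show ?thesis
        proof (cases "q < p'")
          case True
          then have "cinf cw q \<in> set c1" using c1 that(1) by blast
          moreover have "cinf cw q \<in> T" using ps(2) qin cinf_add_length by metis
          ultimately show ?thesis using dc by (auto simp: T_def f)
        next
          case False
          then show ?thesis using nested qin by (cases "q = p'") auto
        qed
      qed
      fix qs
      assume *: "sorted_wrt (<) qs \<and> (\<forall>q\<in>set qs. p \<le> q) \<and> length qs = len w \<and> ev (map (cinf cw) qs) = w"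
      then obtain q qs' where qs: "qs = q # qs'" using len_w by (cases qs) auto
      define u where "u = ev (map (cinf cw) qs')"
      have u: "w = s (cinf cw q) \<circ> u" using * by (simp add: qs u_def)
      have "len u < len w"
        using wlen_le[of A "map (cinf cw) qs'"] * by (simp add: qs u_def)
      moreover have "u = s (cinf cw q) \<circ> w" unfolding u by simp
      ultimately have desc: "\<alpha> (cinf cw q) \<in> inversions w"
        using simple_inversion(1)[OF w] by simp
      have "\<not> q < p'"
      proof
        assume "q < p'"
        then have "cinf cw q \<in> set c1" using c1 * qs by auto
        moreover have "w (omega (cinf cw q)) = omega (cinf cw q)"
        proof (cases "cinf cw q \<in> S")
          case True
          then show ?thesis using fix1 \<open>cinf cw q \<in> set c1\<close> by (simp add: f)
        next
          case False
          then show ?thesis by (intro sortable_fixes[OF st(1)]) (simp add: st_def)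
        qed
        ultimately show False using fixes_omega_not_descent[OF w] desc by blast
      qed
      then consider "p' < q" | "q = p'" by linarith
      then show "qs = p' # ps \<or> (p' # ps, qs) \<in> lexord {(a, b). a < b}"
      proof cases
        case 2
        have "u = v" using \<open>u = s (cinf cw q) \<circ> w\<close> 2 cp' by (simp add: v_def)
        then have "qs' = ps \<or> (ps, qs') \<in> lexord {(a, b). a < b}"
        proof -
          have "sorted_wrt (<) qs'" "\<forall>q\<in>set qs'. Suc p' \<le> q" "length qs' = len v"
            using * qs 2 len_w by auto
          then show ?thesis using first \<open>u = v\<close> unfolding u_def by blast
        qed
        then show ?thesis using 2 by (auto simp: qs)
      qed (simp add: qs)
    qed
  qed
qed

text \<open>Nested blocks amount to closure of the position set under going back one period, since a
  position is determined by its block and its letter.\<close>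

theorem c_sortable_iff:
  assumes "coxeter_word cw"
  shows "c_sortable A cw w \<longleftrightarrow> sortable cw w"
proof
  have cw: "distinct cw" "cw \<noteq> []" using coxeter_word_props[OF assms] by auto
  assume "c_sortable A cw w"
  then obtain ps where ps: "sorted_wrt (<) ps" "length ps = len w" "ev (map (cinf cw) ps) = w"
    and nested: "\<And>m. block cw ps (Suc m) \<subseteq> block cw ps m"
    unfolding c_sortable_def sorting_pos_def subword_pos_def by blast
  have "q \<in> set ps" if q: "q + length cw \<in> set ps" for q
  proof -
    have "cinf cw q \<in> block cw ps (Suc (q div length cw))"
      unfolding block_def using q cw by (auto intro!: exI[of _ "q + length cw"])
    then obtain p where p: "p \<in> set ps" "p div length cw = q div length cw" "cinf cw p = cinf cw q"
    proof -
      have "cinf cw q \<in> block cw ps (q div length cw)"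
        using nested \<open>cinf cw q \<in> block cw ps (Suc (q div length cw))\<close> by blast
      then show ?thesis using that by (auto simp: block_def)
    qed
    have "p mod length cw = q mod length cw"
      using p(3) cw by (simp add: cinf_def nth_eq_iff_index_eq)
    then have "p = q" using p(2) by (metis div_mult_mod_eq)
    then show ?thesis using p(1) by simp
  qed
  \<comment> \<open>A crude bound, each position being at most the sum of all, supplies the finite
    window.\<close>
  moreover have "q < Suc (sum_list ps)" if "q \<in> set ps" for q
    using member_le_sum_list[OF that] by simp
  ultimately have "sortable (filter (\<lambda>i. i \<in> UNIV) (rotate 0 cw)) (ev (map (cinf cw) ps))"
    using ps by (intro sortable_if_nested[OF cw, where k = "Suc (sum_list ps)"]) auto
  then show "sortable cw w" using ps(3) by simp
next
  have cw: "distinct cw" "cw \<noteq> []" using coxeter_word_props[OF assms] by auto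
  assume "sortable cw w"
  then have "sortable (filter (\<lambda>i. i \<in> UNIV) (rotate 0 cw)) w" by simp
  from nested_if_sortable[OF cw(1) this] obtain ps where
    ps: "sorted_wrt (<) ps" "length ps = len w" "ev (map (cinf cw) ps) = w"
    and nested: "\<And>q. q + length cw \<in> set ps \<Longrightarrow> q \<in> set ps"
    and first: "\<And>qs. sorted_wrt (<) qs \<Longrightarrow> length qs = len w \<Longrightarrow> ev (map (cinf cw) qs) = w \<Longrightarrow>
        qs = ps \<or> (ps, qs) \<in> lexord {(a, b). a < b}"
    by auto
  have "block cw ps (Suc m) \<subseteq> block cw ps m" for m
  proof
    fix x assume "x \<in> block cw ps (Suc m)"
    then obtain p where p: "x = cinf cw p" "p \<in> set ps" "p div length cw = Suc m"
      by (auto simp: block_def)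
    have "length cw \<le> p" using p(3) cw by (metis div_less linorder_not_le nat.distinct(1))
    then obtain q where q: "p = q + length cw" by (metis add.commute le_Suc_ex)
    have "q div length cw = m" using p(3) cw by (simp add: q)
    moreover have "q \<in> set ps" using nested p(2) q by simp
    ultimately show "x \<in> block cw ps m" using p(1) q by (auto simp: block_def)
  qed
  then show "c_sortable A cw w"
    unfolding c_sortable_def sorting_pos_def subword_pos_def using ps first by blast
qed

corollary c_singleton_iff:
  assumes "coxeter_word cw"
  shows "c_singleton A cw w \<longleftrightarrow> singleton cw w"
proof -
  have "coxeter_word (rev cw)" using assms by (simp add: coxeter_word_def)
  then show ?thesis
    using c_sortable_iff[OF assms] c_sortable_iff[of "rev cw"] sortable_weyl
    by (auto simp: c_singleton_def c_antisortable_def singleton_def)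
qed

section \<open>Orbits of the fundamental weights and the two polytopes\<close>

text \<open>\<open>w0\<close> is a singleton, so its chain reaches
  \<open>- omega (istar A j)\<close> at a positive exponent \<open>M\<close>. Hence the minimum
  defining \<open>hc\<close> exists and is at most \<open>M\<close>, and the chain covers all powers
  up to it.\<close>

lemma cox_omega_hc:
  assumes "coxeter_word cw"
  shows "(cox A cw ^^ hc A cw j) (omega j) = - omega (istar A j)"
    "k \<le> hc A cw j \<Longrightarrow> \<exists>w. singleton cw w \<and> w (omega j) = (cox A cw ^^ k) (omega j)"
proof -
  note cw = coxeter_word_props[OF assms]
  have "singleton cw w0"
    using sortable_w0[of cw] cw by (simp add: singleton_def w0_w0(1))
  from singleton_chain[OF this cw(1,2), of j] obtain M where
    M: "w0 (omega j) = (cox A cw ^^ M) (omega j)"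
    and chain: "\<forall>k\<le>M. \<exists>w. singleton cw w \<and> inversions w \<subseteq> inversions w0 \<and> w (omega j) = (cox A cw ^^ k) (omega j)"
    unfolding cox_def by (elim exE conjE)
  have istar: "w0 (omega j) = - omega (istar A j)"
    by (rule minus_equation_iff[THEN iffD1, OF w0_omega, symmetric])
  \<comment> \<open>\<open>hc\<close> ranges over positive exponents. For \<open>M = 0\<close> the
    coordinate at \<open>j\<close> would be both 1 and at most 0.\<close>
  have "M \<noteq> 0"
  proof
    assume "M = 0"
    then have "omega j = w0 (omega j)" using M by simp
    then have "omega j j = (- omega (istar A j)) j" unfolding istar by (rule fun_cong)
    then show False by (simp add: omega_apply split: if_splits)
  qed
  let ?P = "\<lambda>h. 0 < h \<and> (cox A cw ^^ h) (omega j) = (\<lambda>k. - omega (istar A j) k)"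
  have eq: "(\<lambda>k. - omega (istar A j) k) = - omega (istar A j)"
    by (rule ext) simp
  have PM: "?P M"
    unfolding eq
  proof
    show "0 < M" using \<open>M \<noteq> 0\<close> by simp
    show "(cox A cw ^^ M) (omega j) = - omega (istar A j)" by (rule trans[OF M[symmetric] istar])
  qed
  then have "?P (hc A cw j)" unfolding hc_def by (rule LeastI[of ?P M])
  then show "(cox A cw ^^ hc A cw j) (omega j) = - omega (istar A j)"
    unfolding eq by (rule conjunct2)
  have "hc A cw j \<le> M" unfolding hc_def by (rule Least_le[of ?P M]) (rule PM)
  then show "k \<le> hc A cw j \<Longrightarrow> \<exists>w. singleton cw w \<and> w (omega j) = (cox A cw ^^ k) (omega j)"
    using chain le_trans by blast
qed

lemma ip_funpow: "w \<in> W \<Longrightarrow> \<langle>(w ^^ k) x, (w ^^ k) x\<rangle> = \<langle>x, x\<rangle>"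
proof (induction k)
  case (Suc k)
  then show ?case using ip_W[OF Suc.prems] by simp
qed simp

text \<open>The orbit of \<open>\<omega>\<^sub>j\<close> cannot descend any further once it has reached an antidominant
  weight: subtracting a positive root from it would strictly increase the norm.\<close>
lemma singleton_omega:
  assumes "coxeter_word cw" "singleton cw w"
  shows "\<exists>m\<le>hc A cw j. w (omega j) = (cox A cw ^^ m) (omega j)"
proof -
  note cw = coxeter_word_props[OF assms(1)]
  define c where "c = cox A cw"
  define h where "h = hc A cw j"
  obtain m where m: "w (omega j) = (c ^^ m) (omega j)"
    and roots: "\<And>k. k < m \<Longrightarrow> (c ^^ k) (omega j) - (c ^^ Suc k) (omega j) \<in> inversions w"
    using singleton_chain[OF assms(2) cw(1,2), of j] unfolding c_def cox_def by blast
  have cW: "c \<in> W" by (simp add: c_def cox_def weylI)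
  have "m \<le> h"
  proof (rule ccontr)
    assume "\<not> m \<le> h"
    \<comment> \<open>Since \<open>h < m\<close>, this step of the chain is an inversion of
      \<open>w\<close>, in particular a positive root.\<close>
    define \<gamma> where "\<gamma> = (c ^^ h) (omega j) - (c ^^ Suc h) (omega j)"
    have \<gamma>: "\<gamma> \<in> roots" "nonneg \<gamma>"
      using roots[of h] \<open>\<not> m \<le> h\<close> by (auto simp: \<gamma>_def inversions_def)
    define o' where "o' = omega (istar A j)"
    have h: "(c ^^ h) (omega j) = - o'"
      using cox_omega_hc(1)[OF assms(1)] by (simp add: c_def h_def o'_def)
    have suc: "(c ^^ Suc h) (omega j) = - o' - \<gamma>"
      unfolding h[symmetric] \<gamma>_def by (simp only: diff_diff_eq2 add_diff_cancel_left')
    have "\<langle>- o' - \<gamma>, - o' - \<gamma>\<rangle> = \<langle>- o', - o'\<rangle>"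
      using ip_funpow[OF cW, of "Suc h" "omega j"] ip_funpow[OF cW, of h "omega j"] by (simp only: suc h)
    then have "2 * \<langle>\<gamma>, o'\<rangle> + \<langle>\<gamma>, \<gamma>\<rangle> = 0"
      by (simp add: ip_linear ip_sym[of o' \<gamma>])
    moreover have "\<langle>\<gamma>, \<gamma>\<rangle> > 0" using ip_pos root_nonzero[OF \<gamma>(1)] by blast
    moreover have "\<langle>\<gamma>, o'\<rangle> = cf (istar A j) \<gamma> * D (istar A j)"
      using D_pos[of "istar A j"] by (simp add: cf_def o'_def)
    moreover have "\<dots> \<ge> 0"
      using \<gamma>(2) D_pos[of "istar A j"] by (intro mult_nonneg_nonneg) (auto simp: nonneg_def)
    ultimately show False by linarith
  qed
  then show ?thesis using m by (auto simp: c_def h_def)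
qed

text \<open>Both polytopes bound the functional on the same weights: \<open>cox_omega_hc\<close>
  realizes each power by a singleton, and \<open>singleton_omega\<close> gives the converse.\<close>

theorem asso_eq:
  assumes "coxeter_word cw" "\<And>j. \<langle>a, omega j\<rangle> = f j"
  shows "asso_a A cw G a = asso_f A cw f"
proof (intro equalityI subsetI)
  fix \<phi> assume \<phi>: "\<phi> \<in> asso_a A cw G a"
  show "\<phi> \<in> asso_f A cw f"
    unfolding asso_f_def
  proof (intro CollectI allI impI)
    fix i m assume "m \<le> hc A cw i"
    then obtain w where "singleton cw w" "w (omega i) = (cox A cw ^^ m) (omega i)"
      using cox_omega_hc(2)[OF assms(1)] by blast
    then show "pair \<phi> ((cox A cw ^^ m) (omega i)) \<le> f i"
    proof -
      have "pair \<phi> (w (omega i)) \<le> \<langle>a, omega i\<rangle>"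
        using \<phi> \<open>singleton cw w\<close> c_singleton_iff[OF assms(1)] unfolding asso_a_def by blast
      then show ?thesis using assms(2)[of i] \<open>w (omega i) = _\<close> by simp
    qed
  qed
next
  fix \<phi> assume \<phi>: "\<phi> \<in> asso_f A cw f"
  show "\<phi> \<in> asso_a A cw G a"
    unfolding asso_a_def
  proof (intro CollectI allI impI)
    fix w j assume "c_singleton A cw w"
    then obtain m where "m \<le> hc A cw j" "w (omega j) = (cox A cw ^^ m) (omega j)"
      using singleton_omega[OF assms(1)] c_singleton_iff[OF assms(1)] by blast
    then show "pair \<phi> (w (omega j)) \<le> \<langle>a, omega j\<rangle>"
      using \<phi> assms(2) by (simp add: asso_f_def)
  qed
qed

text \<open>The prescribed pairings determine the coefficients in simple roots as
  \<open>f i / D i\<close>. Symmetrizing by \<open>D\<close> turns the coordinate at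
  \<open>j\<close> into the given sum divided by \<open>D j\<close>.\<close>

lemma dominant_point_exists:
  assumes "\<And>j. (\<Sum>i\<in>UNIV. of_int (A i j) * f i) \<ge> 0"
  shows "\<exists>a\<in>fund_chamber. \<forall>j. \<langle>a, omega j\<rangle> = f j"
proof -
  define a where "a = (\<Sum>i\<in>UNIV. (f i / D i) \<odot> \<alpha> i)"
  have cf: "cf i a = f i / D i" for i
    by (simp add: a_def cf_sum cf_linear cf_root if_distrib cong: if_cong)
  have "\<langle>a, omega j\<rangle> = f j" for j
    using cf[of j] D_pos[of j] by (simp add: cf_def)
  moreover have "a j \<ge> 0" for j
  proof -
    have e: "of_int (A j i) / D i = of_int (A i j) / D j" for i
      using ip_root_root[of i j] ip_root_root[of j i] ip_sym[of "\<alpha> i" "\<alpha> j"] D_pos[of i] D_pos[of j]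
      by (simp add: field_simps)
    have "a j = (\<Sum>i\<in>UNIV. f i * (of_int (A j i) / D i))"
      by (simp add: coord_cf[of a j] cf)
    also have "\<dots> = (\<Sum>i\<in>UNIV. of_int (A i j) * f i) / D j"
      unfolding e by (simp add: sum_divide_distrib mult.commute)
    also have "\<dots> \<ge> 0" using assms[of j] D_pos[of j] by simp
    finally show ?thesis .
  qed
  ultimately show ?thesis by (auto simp: fund_chamber_def)
qed

end

theorem theorem2p5:
  fixes A :: "'i::finite \<Rightarrow> 'i \<Rightarrow> int" and cw :: "'i list"
    and G :: "'i \<Rightarrow> 'i \<Rightarrow> real" and f :: "'i \<Rightarrow> real"
  assumes "finite_type_cartan A"
    and "W_inv_inner A G"
    and "coxeter_word cw"
    and "\<forall>i. f i = f (istar A i)"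
    and "\<forall>j. (\<Sum>i\<in>UNIV. of_int (A i j) * f i) > 0"
  shows "\<exists>a \<in> fund_chamber. asso_a A cw G a = asso_f A cw f"
proof -
  interpret cartan_weyl A G
    using assms(1,2) by unfold_locales
  obtain a where "a \<in> fund_chamber" "\<And>j. ip G a (omega j) = f j"
    using dominant_point_exists[of f] assms(5) less_imp_le by blast
  then show ?thesis using asso_eq[OF assms(3)] by blast
qed

end
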